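(* Let $X$ be a rack, $k$ a field, $kX$ the vector space with basis $X$, and $W=k\oplus kX$. Make $W$ a coalgebra by linearly extending $\Delta(1)=1\otimes 1$, $\epsilon(1)=1$ (for $1\in k$) and $\Delta(x)=x\otimes x$, $\epsilon(x)=1$ for $x\in X$. Let $q:W\otimes W\to W$ be the linear map determined by $q(x\otimes y)=x\triangleleft y$, $q(1\otimes x)=1$, $q(x\otimes 1)=0$, $q(1\otimes 1)=0$ for $x,y\in X$, i.e. $$q\Big(\big(a+\textstyle\sum_x a_x x\big)\otimes\big(b+\sum_y b_y y\big)\Big)=\sum_y a b_y+\sum_{x,y}a_xb_y\,(x\triangleleft y).$$ Then $q$ is a self-distributive linear map compatible with comultiplication.
   Context: A rack is a set $X$ with a binary operation $\triangleleft$ such that (II) for any $a,b\in X$ there is a unique $c\in X$ with $a=c\triangleleft b$, and (III) $(a\triangleleft b)\triangleleft c=(a\triangleleft c)\triangleleft(b\triangleleft c)$ for all $a,b,c\in X$. For a coalgebra $(C,\Delta)$ with flip $\tau(u\otimes v)=v\otimes u$, a linear map $q:C\otimes C\to C$ is self-distributive if $q(q\otimes 1)=q(q\otimes q)(1\otimes\tau\otimes 1)(1\otimes 1\otimes\Delta)$ as maps $C^{\otimes 3}\to C$; it is compatible with comultiplication if $\Delta q=(q\otimes q)(1\otimes\tau\otimes 1)(\Delta\otimes\Delta)$. Here $1$ inside a composite denotes the identity map. *)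

theory Defs
  imports "HOL-Algebra.AbelCoset" "Jordan_Normal_Form.Missing_VectorSpace"
begin

locale rack =
  fixes X :: "'x set" and rop :: "'x \<Rightarrow> 'x \<Rightarrow> 'x"
  assumes closed: "a \<in> X \<Longrightarrow> b \<in> X \<Longrightarrow> rop a b \<in> X"
    and right_div: "a \<in> X \<Longrightarrow> b \<in> X \<Longrightarrow> \<exists>!c. c \<in> X \<and> a = rop c b"
    and self_distrib:
      "a \<in> X \<Longrightarrow> b \<in> X \<Longrightarrow> c \<in> X \<Longrightarrow> rop (rop a b) c = rop (rop a c) (rop b c)"


section \<open>Free modules and quotient modules\<close>

text \<open>
  The free module on \<open>S\<close> consists of the finitely supported functions \<open>S \<rightarrow> R\<close>; as in
  \<open>func_space\<close>, they are \<open>undefined\<close> outside \<open>S\<close>. In the module records below the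
  fields \<open>mult\<close> and \<open>one\<close> carry no information.
\<close>

definition free_module :: "('r, 'd) ring_scheme \<Rightarrow> 'x set \<Rightarrow> ('r, 'x \<Rightarrow> 'r) module" where
  "free_module R S = (ring.func_space R S)
     \<lparr>carrier := {f \<in> carrier (ring.func_space R S). finite {x \<in> S. f x \<noteq> \<zero>\<^bsub>R\<^esub>}}\<rparr>"

definition free_basis :: "('r, 'd) ring_scheme \<Rightarrow> 'x set \<Rightarrow> 'x \<Rightarrow> ('x \<Rightarrow> 'r)" where
  "free_basis R S x = restrict (\<lambda>y. if y = x then \<one>\<^bsub>R\<^esub> else \<zero>\<^bsub>R\<^esub>) S"

definition free_lift ::
  "('r, 'd) ring_scheme \<Rightarrow> 'x set \<Rightarrow> ('r, 'p, 'e) module_scheme \<Rightarrow> ('x \<Rightarrow> 'p) \<Rightarrow> ('x \<Rightarrow> 'r) \<Rightarrow> 'p" where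
  "free_lift R S P \<phi> f = (\<Oplus>\<^bsub>P\<^esub> x \<in> {x \<in> S. f x \<noteq> \<zero>\<^bsub>R\<^esub>}. f x \<odot>\<^bsub>P\<^esub> \<phi> x)"

definition quotient_module ::
  "('r, 'm, 'd) module_scheme \<Rightarrow> 'm set \<Rightarrow> ('r, 'm set) module" where
  "quotient_module M N =
     \<lparr>carrier = a_rcosets\<^bsub>M\<^esub> N, mult = (\<lambda>_ _. N), one = N, zero = N, add = set_add M,
      smult = (\<lambda>c A. \<Union>x\<in>A. N +>\<^bsub>M\<^esub> (c \<odot>\<^bsub>M\<^esub> x))\<rparr>"

definition self_module :: "('r, 'd) ring_scheme \<Rightarrow> ('r, 'r) module" where
  "self_module R = \<lparr>carrier = carrier R, mult = mult R, one = one R, zero = zero R,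
     add = add R, smult = mult R\<rparr>"


section \<open>Tensor products\<close>

definition tensor_relations ::
  "('r, 'd) ring_scheme \<Rightarrow> ('r, 'm, 'e) module_scheme \<Rightarrow> ('r, 'n, 'f) module_scheme
     \<Rightarrow> ('m \<times> 'n \<Rightarrow> 'r) set" where
  "tensor_relations R M N =
    (let S = carrier M \<times> carrier N; F = free_module R S; \<delta> = free_basis R S in
      {\<delta> (m \<oplus>\<^bsub>M\<^esub> m', n) \<ominus>\<^bsub>F\<^esub> (\<delta> (m, n) \<oplus>\<^bsub>F\<^esub> \<delta> (m', n)) | m m' n.
         m \<in> carrier M \<and> m' \<in> carrier M \<and> n \<in> carrier N}
    \<union> {\<delta> (m, n \<oplus>\<^bsub>N\<^esub> n') \<ominus>\<^bsub>F\<^esub> (\<delta> (m, n) \<oplus>\<^bsub>F\<^esub> \<delta> (m, n')) | m n n'.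
         m \<in> carrier M \<and> n \<in> carrier N \<and> n' \<in> carrier N}
    \<union> {\<delta> (c \<odot>\<^bsub>M\<^esub> m, n) \<ominus>\<^bsub>F\<^esub> c \<odot>\<^bsub>F\<^esub> \<delta> (m, n) | c m n.
         c \<in> carrier R \<and> m \<in> carrier M \<and> n \<in> carrier N}
    \<union> {\<delta> (m, c \<odot>\<^bsub>N\<^esub> n) \<ominus>\<^bsub>F\<^esub> c \<odot>\<^bsub>F\<^esub> \<delta> (m, n) | c m n.
         c \<in> carrier R \<and> m \<in> carrier M \<and> n \<in> carrier N})"

definition tensor_kernel ::
  "('r, 'd) ring_scheme \<Rightarrow> ('r, 'm, 'e) module_scheme \<Rightarrow> ('r, 'n, 'f) module_scheme
     \<Rightarrow> ('m \<times> 'n \<Rightarrow> 'r) set" where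
  "tensor_kernel R M N =
     module.span R (free_module R (carrier M \<times> carrier N)) (tensor_relations R M N)"

definition tensor_product ::
  "('r, 'd) ring_scheme \<Rightarrow> ('r, 'm, 'e) module_scheme \<Rightarrow> ('r, 'n, 'f) module_scheme
     \<Rightarrow> ('r, ('m \<times> 'n \<Rightarrow> 'r) set) module" where
  "tensor_product R M N =
     quotient_module (free_module R (carrier M \<times> carrier N)) (tensor_kernel R M N)"

definition tensor ::
  "('r, 'd) ring_scheme \<Rightarrow> ('r, 'm, 'e) module_scheme \<Rightarrow> ('r, 'n, 'f) module_scheme
     \<Rightarrow> 'm \<Rightarrow> 'n \<Rightarrow> ('m \<times> 'n \<Rightarrow> 'r) set" where
  "tensor R M N m n =
     tensor_kernel R M N +>\<^bsub>free_module R (carrier M \<times> carrier N)\<^esub>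
       free_basis R (carrier M \<times> carrier N) (m, n)"

text \<open>
  The linear map on the tensor product induced by a bilinear map \<open>\<beta>\<close>: the linear extension
  of \<open>\<beta>\<close> to the free module is constant on each coset, so its image is a singleton.
\<close>

definition tensor_lift ::
  "('r, 'd) ring_scheme \<Rightarrow> ('r, 'm, 'e) module_scheme \<Rightarrow> ('r, 'n, 'f) module_scheme
     \<Rightarrow> ('r, 'p, 'g) module_scheme \<Rightarrow> ('m \<Rightarrow> 'n \<Rightarrow> 'p) \<Rightarrow> ('m \<times> 'n \<Rightarrow> 'r) set \<Rightarrow> 'p" where
  "tensor_lift R M N P \<beta> t =
     the_elem (free_lift R (carrier M \<times> carrier N) P (\<lambda>(m, n). \<beta> m n) ` t)"

definition tensor_map ::
  "('r, 'd) ring_scheme \<Rightarrow> ('r, 'm, 'e) module_scheme \<Rightarrow> ('r, 'n, 'f) module_scheme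
     \<Rightarrow> ('r, 'm2, 'e2) module_scheme \<Rightarrow> ('r, 'n2, 'f2) module_scheme
     \<Rightarrow> ('m \<Rightarrow> 'm2) \<Rightarrow> ('n \<Rightarrow> 'n2)
     \<Rightarrow> ('m \<times> 'n \<Rightarrow> 'r) set \<Rightarrow> ('m2 \<times> 'n2 \<Rightarrow> 'r) set" where
  "tensor_map R M N M' N' f g =
     tensor_lift R M N (tensor_product R M' N') (\<lambda>m n. tensor R M' N' (f m) (g n))"

definition tensor_flip ::
  "('r, 'd) ring_scheme \<Rightarrow> ('r, 'm, 'e) module_scheme \<Rightarrow> ('r, 'n, 'f) module_scheme
     \<Rightarrow> ('m \<times> 'n \<Rightarrow> 'r) set \<Rightarrow> ('n \<times> 'm \<Rightarrow> 'r) set" where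
  "tensor_flip R M N = tensor_lift R M N (tensor_product R N M) (\<lambda>m n. tensor R N M n m)"

text \<open>The canonical map \<open>(A \<otimes> B) \<otimes> C \<rightarrow> A \<otimes> (B \<otimes> C)\<close> and its inverse.\<close>

definition tensor_assoc ::
  "('r, 'd) ring_scheme \<Rightarrow> ('r, 'a, 'e) module_scheme \<Rightarrow> ('r, 'b, 'f) module_scheme
     \<Rightarrow> ('r, 'c, 'g) module_scheme
     \<Rightarrow> (('a \<times> 'b \<Rightarrow> 'r) set \<times> 'c \<Rightarrow> 'r) set \<Rightarrow> ('a \<times> ('b \<times> 'c \<Rightarrow> 'r) set \<Rightarrow> 'r) set" where
  "tensor_assoc R A B C =
     (let AB = tensor_product R A B; BC = tensor_product R B C; P = tensor_product R A BC in
      tensor_lift R AB C P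
        (\<lambda>t c. tensor_lift R A B P (\<lambda>a b. tensor R A BC a (tensor R B C b c)) t))"

definition tensor_assoc_inv ::
  "('r, 'd) ring_scheme \<Rightarrow> ('r, 'a, 'e) module_scheme \<Rightarrow> ('r, 'b, 'f) module_scheme
     \<Rightarrow> ('r, 'c, 'g) module_scheme
     \<Rightarrow> ('a \<times> ('b \<times> 'c \<Rightarrow> 'r) set \<Rightarrow> 'r) set \<Rightarrow> (('a \<times> 'b \<Rightarrow> 'r) set \<times> 'c \<Rightarrow> 'r) set" where
  "tensor_assoc_inv R A B C =
     (let AB = tensor_product R A B; BC = tensor_product R B C; P = tensor_product R AB C in
      tensor_lift R A BC P
        (\<lambda>a t. tensor_lift R B C P (\<lambda>b c. tensor R AB C (tensor R A B a b) c) t))"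

text \<open>
  The map \<open>1 \<otimes> \<tau> \<otimes> 1\<close> on the fourfold tensor power, bracketed as
  \<open>(C \<otimes> C) \<otimes> (C \<otimes> C)\<close>: rebracket to \<open>C \<otimes> ((C \<otimes> C) \<otimes> C)\<close>, flip the inner factor,
  and rebracket back.
\<close>

definition middle_flip ::
  "('r, 'd) ring_scheme \<Rightarrow> ('r, 'c, 'e) module_scheme
     \<Rightarrow> (('c \<times> 'c \<Rightarrow> 'r) set \<times> ('c \<times> 'c \<Rightarrow> 'r) set \<Rightarrow> 'r) set
     \<Rightarrow> (('c \<times> 'c \<Rightarrow> 'r) set \<times> ('c \<times> 'c \<Rightarrow> 'r) set \<Rightarrow> 'r) set" where
  "middle_flip R C =
     (let CC = tensor_product R C C;
          C_CC = tensor_product R C CC;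
          CC_C = tensor_product R CC C in
      tensor_assoc_inv R C C CC
      \<circ> tensor_map R C CC_C C C_CC id (tensor_assoc R C C C)
      \<circ> tensor_map R C CC_C C CC_C id (tensor_map R CC C CC C (tensor_flip R C C) id)
      \<circ> tensor_map R C C_CC C CC_C id (tensor_assoc_inv R C C C)
      \<circ> tensor_assoc R C C CC)"


section \<open>Coalgebras and self-distributive maps\<close>

definition coalgebra ::
  "('r, 'd) ring_scheme \<Rightarrow> ('r, 'c, 'e) module_scheme
     \<Rightarrow> ('c \<Rightarrow> ('c \<times> 'c \<Rightarrow> 'r) set) \<Rightarrow> ('c \<Rightarrow> 'r) \<Rightarrow> bool" where
  "coalgebra R C \<Delta> \<epsilon> \<longleftrightarrow>
     (let CC = tensor_product R C C; K = self_module R in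
      linear_map R C CC \<Delta> \<and> linear_map R C K \<epsilon> \<and>
      (\<forall>c \<in> carrier C.
         tensor_assoc R C C C (tensor_map R C C CC C \<Delta> id (\<Delta> c))
           = tensor_map R C C C CC id \<Delta> (\<Delta> c) \<and>
         tensor_lift R K C C (\<lambda>a x. a \<odot>\<^bsub>C\<^esub> x) (tensor_map R C C K C \<epsilon> id (\<Delta> c)) = c \<and>
         tensor_lift R C K C (\<lambda>x a. a \<odot>\<^bsub>C\<^esub> x) (tensor_map R C C C K id \<epsilon> (\<Delta> c)) = c))"

text \<open>The threefold tensor power is bracketed as \<open>(C \<otimes> C) \<otimes> C\<close>.\<close>

definition self_distributive ::
  "('r, 'd) ring_scheme \<Rightarrow> ('r, 'c, 'e) module_scheme
     \<Rightarrow> ('c \<Rightarrow> ('c \<times> 'c \<Rightarrow> 'r) set) \<Rightarrow> (('c \<times> 'c \<Rightarrow> 'r) set \<Rightarrow> 'c) \<Rightarrow> bool" where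
  "self_distributive R C \<Delta> q \<longleftrightarrow>
     (let CC = tensor_product R C C in
      \<forall>t \<in> carrier (tensor_product R CC C).
        (q \<circ> tensor_map R CC C C C q id) t
        = (q \<circ> tensor_map R CC CC C C q q \<circ> middle_flip R C
             \<circ> tensor_map R CC C CC CC (tensor_map R C C C C id id) \<Delta>) t)"

definition comult_compatible ::
  "('r, 'd) ring_scheme \<Rightarrow> ('r, 'c, 'e) module_scheme
     \<Rightarrow> ('c \<Rightarrow> ('c \<times> 'c \<Rightarrow> 'r) set) \<Rightarrow> (('c \<times> 'c \<Rightarrow> 'r) set \<Rightarrow> 'c) \<Rightarrow> bool" where
  "comult_compatible R C \<Delta> q \<longleftrightarrow>
     (let CC = tensor_product R C C in
      \<forall>t \<in> carrier CC.
        (\<Delta> \<circ> q) t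
        = (tensor_map R CC CC C C q q \<circ> middle_flip R C \<circ> tensor_map R C C CC CC \<Delta> \<Delta>) t)"


section \<open>The coalgebra of a rack\<close>

definition rack_space :: "('r, 'd) ring_scheme \<Rightarrow> 'x set \<Rightarrow> ('r, 'r \<times> ('x \<Rightarrow> 'r)) module" where
  "rack_space k X = direct_sum (self_module k) (free_module k X)"

definition rack_unit :: "('r, 'd) ring_scheme \<Rightarrow> 'x set \<Rightarrow> 'r \<times> ('x \<Rightarrow> 'r)" where
  "rack_unit k X = inj1 (self_module k) (free_module k X) \<one>\<^bsub>k\<^esub>"

definition rack_elem :: "('r, 'd) ring_scheme \<Rightarrow> 'x set \<Rightarrow> 'x \<Rightarrow> 'r \<times> ('x \<Rightarrow> 'r)" where
  "rack_elem k X x = inj2 (self_module k) (free_module k X) (free_basis k X x)"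

text \<open>
  Linear extension to \<open>k \<oplus> kX\<close> of a map given by its value \<open>u\<close> at \<open>1\<close> and its values
  \<open>\<phi> x\<close> at the elements \<open>x\<close> of \<open>X\<close>.
\<close>

definition rack_extend ::
  "('r, 'd) ring_scheme \<Rightarrow> 'x set \<Rightarrow> ('r, 'p, 'e) module_scheme \<Rightarrow> 'p \<Rightarrow> ('x \<Rightarrow> 'p)
     \<Rightarrow> 'r \<times> ('x \<Rightarrow> 'r) \<Rightarrow> 'p" where
  "rack_extend k X P u \<phi> w = fst w \<odot>\<^bsub>P\<^esub> u \<oplus>\<^bsub>P\<^esub> free_lift k X P \<phi> (snd w)"

definition rack_comult ::
  "('r, 'd) ring_scheme \<Rightarrow> 'x set \<Rightarrow> 'r \<times> ('x \<Rightarrow> 'r)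
     \<Rightarrow> (('r \<times> ('x \<Rightarrow> 'r)) \<times> ('r \<times> ('x \<Rightarrow> 'r)) \<Rightarrow> 'r) set" where
  "rack_comult k X =
     (let W = rack_space k X; g = (\<lambda>w. tensor k W W w w) in
      rack_extend k X (tensor_product k W W) (g (rack_unit k X)) (\<lambda>x. g (rack_elem k X x)))"

definition rack_counit ::
  "('r, 'd) ring_scheme \<Rightarrow> 'x set \<Rightarrow> 'r \<times> ('x \<Rightarrow> 'r) \<Rightarrow> 'r" where
  "rack_counit k X = rack_extend k X (self_module k) \<one>\<^bsub>k\<^esub> (\<lambda>x. \<one>\<^bsub>k\<^esub>)"

text \<open>
  The sums in the value at \<open>(a + \<Sum>\<^sub>x a\<^sub>x x) \<otimes> (b + \<Sum>\<^sub>y b\<^sub>y y)\<close> are taken over the supports;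
  the first one is the component in \<open>k\<close>, the second one the component in \<open>kX\<close>.
\<close>

definition rack_q ::
  "('r, 'd) ring_scheme \<Rightarrow> 'x set \<Rightarrow> ('x \<Rightarrow> 'x \<Rightarrow> 'x)
     \<Rightarrow> (('r \<times> ('x \<Rightarrow> 'r)) \<times> ('r \<times> ('x \<Rightarrow> 'r)) \<Rightarrow> 'r) set \<Rightarrow> 'r \<times> ('x \<Rightarrow> 'r)" where
  "rack_q k X rop =
     (let W = rack_space k X; supp = (\<lambda>f. {x \<in> X. f x \<noteq> \<zero>\<^bsub>k\<^esub>}) in
      tensor_lift k W W W (\<lambda>(a, f) (b, g).
        (\<Oplus>\<^bsub>k\<^esub> y \<in> supp g. a \<otimes>\<^bsub>k\<^esub> g y,
         \<Oplus>\<^bsub>free_module k X\<^esub> p \<in> supp f \<times> supp g.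
           (f (fst p) \<otimes>\<^bsub>k\<^esub> g (snd p))
             \<odot>\<^bsub>free_module k X\<^esub> free_basis k X (rop (fst p) (snd p)))))"

end

theory Submission
  imports Defs
begin

text \<open>
  Write \<open>W = k \<oplus> kX\<close> and let \<open>G\<close> be its basis, the element \<open>1 \<in> k\<close> together with \<open>X\<close>. The
  comultiplication makes every element of \<open>G\<close> grouplike, \<open>\<Delta> g = g \<otimes> g\<close> and \<open>\<epsilon> g = 1\<close>, and \<open>q\<close>
  sends \<open>g \<otimes> h\<close> with \<open>g, h \<in> G\<close> to an element of \<open>G\<close> or to \<open>0\<close>. All the identities to be
  proved are equalities of linear maps out of \<open>W\<close>, \<open>W \<otimes> W\<close> and \<open>(W \<otimes> W) \<otimes> W\<close>, so it is
  enough to compare the two sides on \<open>G\<close> and on pure tensors of elements of \<open>G\<close>.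

  There the coalgebra axioms are immediate (\<open>coalgebra_of_grouplikes\<close>). Compatibility of \<open>q\<close> with
  \<open>\<Delta>\<close> says that \<open>q (g \<otimes> h)\<close> is again grouplike or zero (\<open>comult_compatible_of_grouplikes\<close>), and
  self-distributivity becomes
  \<open>q (q (a \<otimes> b) \<otimes> c) = q (q (a \<otimes> c) \<otimes> q (b \<otimes> c))\<close> for \<open>a, b, c \<in> G\<close>
  (\<open>self_distributive_of_grouplikes\<close>). If \<open>c = 1\<close> both sides vanish, as \<open>q\<close> kills \<open>g \<otimes> 1\<close>. Let
  \<open>c \<in> X\<close>. For \<open>a, b \<in> X\<close> the identity is the self-distributivity of the rack; for \<open>a = 1\<close>,
  \<open>b \<in> X\<close> both sides are \<open>1\<close>; for \<open>b = 1\<close> both sides vanish, the left one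
  because \<open>q (a \<otimes> 1) = 0\<close> and the right one because \<open>q (1 \<otimes> c) = 1\<close>.

  The bulk of the work is the linear algebra that justifies testing on pure tensors: the universal
  property of the tensor product (\<open>tensor_lift_mod_hom\<close>, \<open>tensor_lift_tensor\<close>), the fact that
  generating sets of the factors yield a generating set of pure tensors (\<open>span_pure_tensors\<close>), and
  the resulting linearity and values on pure tensors of all maps built from \<open>tensor_lift\<close>.
\<close>

section \<open>Linear maps and generating sets\<close>

lemma mod_homI:
  assumes "module R M" "module R N"
    and "\<And>x. x \<in> carrier M \<Longrightarrow> f x \<in> carrier N"
    and "\<And>x y. x \<in> carrier M \<Longrightarrow> y \<in> carrier M \<Longrightarrow> f (x \<oplus>\<^bsub>M\<^esub> y) = f x \<oplus>\<^bsub>N\<^esub> f y"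
    and "\<And>c x. c \<in> carrier R \<Longrightarrow> x \<in> carrier M \<Longrightarrow> f (c \<odot>\<^bsub>M\<^esub> x) = c \<odot>\<^bsub>N\<^esub> f x"
  shows "mod_hom R M N f"
  using assms by (auto simp: mod_hom_def mod_hom_axioms_def module_hom_def)

lemma mod_hom_modules:
  assumes "mod_hom R M N f"
  shows "module R M" "module R N"
  using assms by (auto simp: mod_hom_def)

lemma mod_hom_map_add:
  assumes "mod_hom R M N f" "x \<in> carrier M" "y \<in> carrier M"
  shows "f (x \<oplus>\<^bsub>M\<^esub> y) = f x \<oplus>\<^bsub>N\<^esub> f y"
  using assms by (simp add: mod_hom_def mod_hom_axioms_def module_hom_def)

lemma mod_hom_map_smult:
  assumes "mod_hom R M N f" "c \<in> carrier R" "x \<in> carrier M"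
  shows "f (c \<odot>\<^bsub>M\<^esub> x) = c \<odot>\<^bsub>N\<^esub> f x"
  using assms by (simp add: mod_hom_def mod_hom_axioms_def module_hom_def)

lemma mod_hom_cong:
  assumes f: "mod_hom R M N f" and eq: "\<And>x. x \<in> carrier M \<Longrightarrow> f x = g x"
  shows "mod_hom R M N g"
proof -
  interpret mod_hom R M N f by fact
  show ?thesis
    by (rule mod_homI) (auto simp flip: eq intro: M.module_axioms N.module_axioms)
qed

lemma mod_hom_id: "module R M \<Longrightarrow> mod_hom R M M id"
  by (rule mod_homI) auto

lemma mod_hom_comp:
  assumes "mod_hom R M N f" "mod_hom R N P g"
  shows "mod_hom R M P (\<lambda>x. g (f x))"
proof -
  interpret f: mod_hom R M N f by fact
  interpret g: mod_hom R N P g by fact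
  show ?thesis
    by (rule mod_homI) (auto intro: f.M.module_axioms g.N.module_axioms)
qed

lemma mod_hom_add:
  assumes "mod_hom R M N f" "mod_hom R M N g"
  shows "mod_hom R M N (\<lambda>x. f x \<oplus>\<^bsub>N\<^esub> g x)"
proof -
  interpret f: mod_hom R M N f by fact
  interpret g: mod_hom R M N g by fact
  show ?thesis
    by (rule mod_homI)
      (auto simp: f.N.smult_r_distr f.N.M.a_ac intro: f.M.module_axioms f.N.module_axioms)
qed

lemma mod_hom_smult:
  assumes "mod_hom R M N f" and c: "c \<in> carrier R"
  shows "mod_hom R M N (\<lambda>x. c \<odot>\<^bsub>N\<^esub> f x)"
proof -
  interpret f: mod_hom R M N f by fact
  have "c \<odot>\<^bsub>N\<^esub> (d \<odot>\<^bsub>N\<^esub> f x) = d \<odot>\<^bsub>N\<^esub> (c \<odot>\<^bsub>N\<^esub> f x)" if "d \<in> carrier R" "x \<in> carrier M" for d x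
    using that c by (simp flip: f.N.smult_assoc1 add: f.R.m_comm)
  then show ?thesis
    using c by (intro mod_homI)
      (auto simp: f.N.smult_r_distr intro: f.M.module_axioms f.N.module_axioms)
qed

lemma mod_hom_zero:
  assumes "module R M" "module R N"
  shows "mod_hom R M N (\<lambda>x. \<zero>\<^bsub>N\<^esub>)"
proof -
  interpret N: module R N by fact
  show ?thesis by (rule mod_homI) (auto intro: assms)
qed

text \<open>
  Operations that are computed on representatives inherit the module laws; the target is not
  presupposed to be a module, so that this establishes quotients as modules.
\<close>

lemma mod_hom_surj_image:
  assumes M: "module R M" and surj: "carrier Q = p ` carrier M"
    and zero: "\<zero>\<^bsub>Q\<^esub> = p \<zero>\<^bsub>M\<^esub>"
    and add: "\<And>x y. x \<in> carrier M \<Longrightarrow> y \<in> carrier M \<Longrightarrow> p x \<oplus>\<^bsub>Q\<^esub> p y = p (x \<oplus>\<^bsub>M\<^esub> y)"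
    and smult: "\<And>c x. c \<in> carrier R \<Longrightarrow> x \<in> carrier M \<Longrightarrow> c \<odot>\<^bsub>Q\<^esub> p x = p (c \<odot>\<^bsub>M\<^esub> x)"
  shows "mod_hom R M Q p"
proof -
  interpret module R M by fact
  have neg: "\<exists>y\<in>carrier M. p x \<oplus>\<^bsub>Q\<^esub> p y = \<zero>\<^bsub>Q\<^esub>" if "x \<in> carrier M" for x
    using that by (intro bexI[of _ "\<ominus>\<^bsub>M\<^esub> x"]) (simp_all add: zero add M.r_neg)
  have "module R Q"
    by (rule module_criteria)
      (use neg in \<open>auto simp: surj zero add smult M.a_ac smult_l_distr smult_r_distr smult_assoc1
        intro: R.is_cring\<close>)
  then show ?thesis
    by (intro mod_homI) (auto simp: surj zero add smult M)
qed

lemma mod_hom_finsum: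
  assumes "mod_hom R M N f" and "g \<in> A \<rightarrow> carrier M"
  shows "f (finsum M g A) = (\<Oplus>\<^bsub>N\<^esub>a\<in>A. f (g a))"
proof -
  interpret mod_hom R M N f by fact
  from assms(2) show ?thesis
    by (induction A rule: infinite_finite_induct) (auto simp: Pi_def)
qed

lemma mod_hom_finsum_family:
  assumes "module R M" "module R N" and "\<And>i. i \<in> I \<Longrightarrow> mod_hom R M N (h i)"
  shows "mod_hom R M N (\<lambda>x. \<Oplus>\<^bsub>N\<^esub>i\<in>I. h i x)"
proof -
  interpret N: module R N by fact
  from assms(3) show ?thesis
  proof (induction I rule: infinite_finite_induct)
    case (insert i I)
    then have "mod_hom R M N (\<lambda>x. h i x \<oplus>\<^bsub>N\<^esub> (\<Oplus>\<^bsub>N\<^esub>i\<in>I. h i x))"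
      by (intro mod_hom_add) auto
    then show ?case
    proof (rule mod_hom_cong)
      fix x assume "x \<in> carrier M"
      then have "h j x \<in> carrier N" if "j \<in> insert i I" for j
        using mod_hom.f_im[OF insert.prems[OF that]] by blast
      then show "h i x \<oplus>\<^bsub>N\<^esub> (\<Oplus>\<^bsub>N\<^esub>i\<in>I. h i x) = (\<Oplus>\<^bsub>N\<^esub>i\<in>insert i I. h i x)"
        using insert.hyps by (intro N.M.finsum_insert[symmetric]) auto
    qed
  qed (simp_all add: mod_hom_zero assms(1,2))
qed

text \<open>
  Preimages of submodules and equalizers of linear maps are submodules, so they contain a span as
  soon as they contain its generators. Every later verification on generators rests on this.
\<close>

lemma submodule_vimage:
  assumes f: "mod_hom R M N f" and K: "submodule R K N"
  shows "submodule R {x \<in> carrier M. f x \<in> K} M"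
proof -
  interpret mod_hom R M N f by fact
  interpret K: submodule R K N by fact
  show ?thesis
    by unfold_locales (auto intro: M.module_axioms)
qed

lemma span_subset_submodule:
  assumes "submodule R K M" "G \<subseteq> K"
  shows "module.span R M G \<subseteq> K"
  using assms module.span_is_subset submodule.module by blast

lemma mod_hom_eq_on_span:
  assumes f: "mod_hom R M N f" and g: "mod_hom R M N g"
    and G: "G \<subseteq> carrier M" and eq: "\<And>x. x \<in> G \<Longrightarrow> f x = g x"
    and x: "x \<in> module.span R M G"
  shows "f x = g x"
proof -
  interpret f: mod_hom R M N f by fact
  interpret g: mod_hom R M N g by fact
  have "submodule R {x \<in> carrier M. f x = g x} M"
    by unfold_locales auto
  then show ?thesis
    using span_subset_submodule[of R "{x \<in> carrier M. f x = g x}" M G] G eq x by auto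
qed

lemma submodule_finsum_closed:
  assumes K: "submodule R K M" and g: "g \<in> A \<rightarrow> K"
  shows "finsum M g A \<in> K"
proof -
  interpret K: submodule R K M by fact
  interpret module R M by (rule K.module)
  from g show ?thesis
  proof (induction A rule: infinite_finite_induct)
    case (insert a A)
    moreover from this have "finsum M g (insert a A) = g a \<oplus>\<^bsub>M\<^esub> finsum M g A"
      using K.subset by (intro M.finsum_insert) auto
    ultimately show ?case
      by auto
  qed auto
qed

lemma span_carrier: "module R M \<Longrightarrow> module.span R M (carrier M) = carrier M"
  by (intro equalityI module.span_is_subset2 module.in_own_span order_refl)

section \<open>Free modules\<close>

lemma free_module_simps:
  assumes "cring R"
  shows "carrier (free_module R S) = {f \<in> S \<rightarrow>\<^sub>E carrier R. finite {x \<in> S. f x \<noteq> \<zero>\<^bsub>R\<^esub>}}"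
    and "\<zero>\<^bsub>free_module R S\<^esub> = restrict (\<lambda>x. \<zero>\<^bsub>R\<^esub>) S"
    and "f \<oplus>\<^bsub>free_module R S\<^esub> g = restrict (\<lambda>x. f x \<oplus>\<^bsub>R\<^esub> g x) S"
    and "c \<odot>\<^bsub>free_module R S\<^esub> f = restrict (\<lambda>x. c \<otimes>\<^bsub>R\<^esub> f x) S"
  using cring.axioms(1)[OF assms] by (simp_all add: free_module_def ring.func_space_def)

lemma free_module_module:
  assumes "cring R"
  shows "module R (free_module R S)"
proof -
  interpret cring R by fact
  have simps: "carrier (func_space S) = S \<rightarrow>\<^sub>E carrier R"
    "\<zero>\<^bsub>func_space S\<^esub> = restrict (\<lambda>x. \<zero>\<^bsub>R\<^esub>) S"
    "f \<oplus>\<^bsub>func_space S\<^esub> g = restrict (\<lambda>x. f x \<oplus>\<^bsub>R\<^esub> g x) S"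
    "c \<odot>\<^bsub>func_space S\<^esub> f = restrict (\<lambda>x. c \<otimes>\<^bsub>R\<^esub> f x) S" for f g c
    by (simp_all add: func_space_def)
  have FS: "module R (func_space S)"
    by (rule func_space_is_module)
  let ?C = "{f \<in> carrier (func_space S). finite {x \<in> S. f x \<noteq> \<zero>\<^bsub>R\<^esub>}}"
  have "submodule R ?C (func_space S)"
  proof (intro submodule.intro FS)
    fix f g
    assume f: "f \<in> ?C" and g: "g \<in> ?C"
    have "{x \<in> S. (f \<oplus>\<^bsub>func_space S\<^esub> g) x \<noteq> \<zero>\<^bsub>R\<^esub>}
        \<subseteq> {x \<in> S. f x \<noteq> \<zero>\<^bsub>R\<^esub>} \<union> {x \<in> S. g x \<noteq> \<zero>\<^bsub>R\<^esub>}"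
      by (auto simp: simps)
    then have "finite {x \<in> S. (f \<oplus>\<^bsub>func_space S\<^esub> g) x \<noteq> \<zero>\<^bsub>R\<^esub>}"
      by (rule finite_subset) (use f g in simp)
    then show "f \<oplus>\<^bsub>func_space S\<^esub> g \<in> ?C"
      using f g by (auto simp: simps)
  next
    fix c f
    assume c: "c \<in> carrier R" and f: "f \<in> ?C"
    have "{x \<in> S. (c \<odot>\<^bsub>func_space S\<^esub> f) x \<noteq> \<zero>\<^bsub>R\<^esub>} \<subseteq> {x \<in> S. f x \<noteq> \<zero>\<^bsub>R\<^esub>}"
      using c by (auto simp: simps)
    then have "finite {x \<in> S. (c \<odot>\<^bsub>func_space S\<^esub> f) x \<noteq> \<zero>\<^bsub>R\<^esub>}"
      by (rule finite_subset) (use f in simp)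
    then show "c \<odot>\<^bsub>func_space S\<^esub> f \<in> ?C"
      using c f by (auto simp: simps)
  qed (auto simp: simps)
  then show ?thesis
    unfolding free_module_def by (rule module.submodule_is_module[OF FS])
qed

lemma free_basis_closed:
  assumes "cring R" "x \<in> S"
  shows "free_basis R S x \<in> carrier (free_module R S)"
proof -
  interpret cring R by fact
  have "finite {y \<in> S. free_basis R S x y \<noteq> \<zero>\<^bsub>R\<^esub>}"
    by (rule finite_subset[of _ "{x}"]) (auto simp: free_basis_def)
  then show ?thesis
    by (auto simp: free_module_simps[OF is_cring] free_basis_def)
qed

lemma self_module_module:
  assumes "cring R"
  shows "module R (self_module R)"
proof -
  interpret cring R by fact
  show ?thesis
    by (rule module_criteria)
      (auto simp: self_module_def a_ac m_assoc l_distr r_distr intro: is_cring r_neg)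
qed

lemma finsum_self_module: "finsum (self_module R) = finsum R"
  by (intro ext) (simp add: finsum_def finprod_def self_module_def)

text \<open>
  The defining sum runs over a support that varies with the argument. Enlarging it to a common
  finite set is what makes the sums for different arguments comparable, as additivity requires.
\<close>

lemma free_lift_eq_sum:
  assumes P: "module R P" and \<phi>: "\<And>x. x \<in> S \<Longrightarrow> \<phi> x \<in> carrier P"
    and f: "f \<in> carrier (free_module R S)"
    and A: "finite A" "{x \<in> S. f x \<noteq> \<zero>\<^bsub>R\<^esub>} \<subseteq> A" "A \<subseteq> S"
  shows "free_lift R S P \<phi> f = (\<Oplus>\<^bsub>P\<^esub>x\<in>A. f x \<odot>\<^bsub>P\<^esub> \<phi> x)"
proof -
  interpret module R P by fact
  have "f x \<in> carrier R" if "x \<in> S" for x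
    using f that by (auto simp: free_module_simps[OF R.is_cring])
  with A \<phi> show ?thesis
    unfolding free_lift_def
    by (intro M.add.finprod_mono_neutral_cong_left) auto
qed

lemma free_lift_mod_hom:
  assumes P: "module R P" and \<phi>: "\<And>x. x \<in> S \<Longrightarrow> \<phi> x \<in> carrier P"
  shows "mod_hom R (free_module R S) P (free_lift R S P \<phi>)"
proof -
  interpret module R P by fact
  interpret F: module R "free_module R S" by (rule free_module_module) (rule R.is_cring)
  note simps = free_module_simps[OF R.is_cring]
  have coeff: "f x \<in> carrier R" if "f \<in> carrier (free_module R S)" "x \<in> S" for f x
    using that by (auto simp: simps)
  show ?thesis
  proof (rule mod_homI)
    fix f
    assume "f \<in> carrier (free_module R S)"
    then show "free_lift R S P \<phi> f \<in> carrier P"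
      by (auto simp: free_lift_def coeff \<phi> intro!: M.finsum_closed)
  next
    fix f g
    assume f: "f \<in> carrier (free_module R S)" and g: "g \<in> carrier (free_module R S)"
    let ?A = "{x \<in> S. f x \<noteq> \<zero>\<^bsub>R\<^esub>} \<union> {x \<in> S. g x \<noteq> \<zero>\<^bsub>R\<^esub>}"
    have A: "finite ?A"
      using f g by (auto simp: simps)
    note sum = free_lift_eq_sum[OF P \<phi> _ A]
    have "free_lift R S P \<phi> (f \<oplus>\<^bsub>free_module R S\<^esub> g)
        = (\<Oplus>\<^bsub>P\<^esub>x\<in>?A. (f \<oplus>\<^bsub>free_module R S\<^esub> g) x \<odot>\<^bsub>P\<^esub> \<phi> x)"
      using f g by (intro sum F.M.add.m_closed) (auto simp: simps(3))
    also have "\<dots> = (\<Oplus>\<^bsub>P\<^esub>x\<in>?A. f x \<odot>\<^bsub>P\<^esub> \<phi> x \<oplus>\<^bsub>P\<^esub> g x \<odot>\<^bsub>P\<^esub> \<phi> x)"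
      using f g by (intro M.finsum_cong') (auto simp: simps smult_l_distr coeff \<phi>)
    also have "\<dots> = free_lift R S P \<phi> f \<oplus>\<^bsub>P\<^esub> free_lift R S P \<phi> g"
      using f g by (subst (1 2) sum) (auto simp: coeff \<phi> intro!: M.finsum_addf)
    finally show "free_lift R S P \<phi> (f \<oplus>\<^bsub>free_module R S\<^esub> g)
        = free_lift R S P \<phi> f \<oplus>\<^bsub>P\<^esub> free_lift R S P \<phi> g" .
  next
    fix c f
    assume c: "c \<in> carrier R" and f: "f \<in> carrier (free_module R S)"
    let ?A = "{x \<in> S. f x \<noteq> \<zero>\<^bsub>R\<^esub>}"
    have A: "finite ?A"
      using f by (auto simp: simps)
    have "free_lift R S P \<phi> (c \<odot>\<^bsub>free_module R S\<^esub> f)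
        = (\<Oplus>\<^bsub>P\<^esub>x\<in>?A. (c \<odot>\<^bsub>free_module R S\<^esub> f) x \<odot>\<^bsub>P\<^esub> \<phi> x)"
      using c by (intro free_lift_eq_sum[OF P \<phi> F.smult_closed[OF c f] A]) (auto simp: simps(4))
    also have "\<dots> = (\<Oplus>\<^bsub>P\<^esub>x\<in>?A. c \<odot>\<^bsub>P\<^esub> (f x \<odot>\<^bsub>P\<^esub> \<phi> x))"
      using c f by (intro M.finsum_cong') (auto simp: simps smult_assoc1 coeff \<phi>)
    also have "\<dots> = c \<odot>\<^bsub>P\<^esub> free_lift R S P \<phi> f"
      using c f unfolding free_lift_def by (intro finsum_smult[symmetric]) (auto simp: coeff \<phi>)
    finally show "free_lift R S P \<phi> (c \<odot>\<^bsub>free_module R S\<^esub> f) = c \<odot>\<^bsub>P\<^esub> free_lift R S P \<phi> f" .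
  qed (fact F.module_axioms P)+
qed

lemma free_lift_basis:
  assumes P: "module R P" and \<phi>: "\<And>x. x \<in> S \<Longrightarrow> \<phi> x \<in> carrier P" and x: "x \<in> S"
  shows "free_lift R S P \<phi> (free_basis R S x) = \<phi> x"
proof -
  interpret module R P by fact
  have "free_lift R S P \<phi> (free_basis R S x) = (\<Oplus>\<^bsub>P\<^esub>y\<in>{x}. free_basis R S x y \<odot>\<^bsub>P\<^esub> \<phi> y)"
    using x by (intro free_lift_eq_sum P \<phi> free_basis_closed R.is_cring)
      (auto simp: free_basis_def)
  also have "\<dots> = \<phi> x"
    using x \<phi>[OF x] by (simp add: free_basis_def)
  finally show ?thesis .
qed

lemma mod_hom_free_lift:
  assumes T: "mod_hom R P Q T" and \<phi>: "\<And>x. x \<in> S \<Longrightarrow> \<phi> x \<in> carrier P"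
    and f: "f \<in> carrier (free_module R S)"
  shows "T (free_lift R S P \<phi> f) = free_lift R S Q (\<lambda>x. T (\<phi> x)) f"
proof -
  interpret T: mod_hom R P Q T by fact
  have coeff: "f x \<in> carrier R" if "x \<in> S" for x
    using f that by (auto simp: free_module_simps[OF T.R.is_cring])
  have "T (free_lift R S P \<phi> f) = (\<Oplus>\<^bsub>Q\<^esub>x\<in>{x \<in> S. f x \<noteq> \<zero>\<^bsub>R\<^esub>}. T (f x \<odot>\<^bsub>P\<^esub> \<phi> x))"
    unfolding free_lift_def by (rule mod_hom_finsum[OF T]) (auto simp: coeff \<phi>)
  also have "\<dots> = free_lift R S Q (\<lambda>x. T (\<phi> x)) f"
    unfolding free_lift_def by (rule T.N.M.finsum_cong') (auto simp: coeff \<phi>)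
  finally show ?thesis .
qed

lemma free_lift_zero:
  assumes P: "module R P" and f: "f \<in> carrier (free_module R S)"
  shows "free_lift R S P (\<lambda>x. \<zero>\<^bsub>P\<^esub>) f = \<zero>\<^bsub>P\<^esub>"
proof -
  interpret module R P by fact
  have "f x \<in> carrier R" if "x \<in> S" for x
    using f that by (auto simp: free_module_simps[OF R.is_cring])
  then show ?thesis
    unfolding free_lift_def by (intro M.add.finprod_one_eqI) simp
qed

text \<open>
  Evaluation at a point of \<open>S\<close> is linear, so it can be applied termwise to the sum of basis vectors;
  only the term of that point survives.
\<close>

lemma free_module_expansion:
  assumes R: "cring R" and f: "f \<in> carrier (free_module R S)"
  shows "f = free_lift R S (free_module R S) (free_basis R S) f"
proof -
  interpret cring R by fact
  let ?F = "free_module R S" and ?A = "{x \<in> S. f x \<noteq> \<zero>\<^bsub>R\<^esub>}"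
  note simps = free_module_simps[OF R]
  interpret F: module R ?F by (rule free_module_module) fact
  have lift: "free_lift R S ?F (free_basis R S) f \<in> carrier ?F"
    using f by (intro mod_hom.f_im[OF free_lift_mod_hom])
      (auto intro: F.module_axioms free_basis_closed[OF R])
  have coeff: "f x \<in> carrier R" if "x \<in> S" for x
    using f that by (auto simp: simps)
  have fin: "finite ?A"
    using f by (simp add: simps)
  have "f y = free_lift R S ?F (free_basis R S) f y" if y: "y \<in> S" for y
  proof -
    have ev: "mod_hom R ?F (self_module R) (\<lambda>f. f y)"
      using y by (intro mod_homI F.module_axioms self_module_module[OF R])
        (auto simp: simps self_module_def)
    interpret K: module R "self_module R" by (rule self_module_module) fact
    have "free_lift R S ?F (free_basis R S) f y
        = (\<Oplus>\<^bsub>self_module R\<^esub>x\<in>?A. (f x \<odot>\<^bsub>?F\<^esub> free_basis R S x) y)"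
      unfolding free_lift_def by (intro mod_hom_finsum[OF ev])
        (auto simp: coeff free_basis_closed[OF R])
    also have "\<dots> = (\<Oplus>\<^bsub>self_module R\<^esub>x\<in>?A. if y = x then f x else \<zero>\<^bsub>self_module R\<^esub>)"
      using y by (intro K.M.finsum_cong') (auto simp: simps free_basis_def self_module_def coeff)
    also have "\<dots> = f y"
    proof (cases "f y = \<zero>\<^bsub>R\<^esub>")
      case True
      then have "(\<Oplus>\<^bsub>self_module R\<^esub>x\<in>?A. if y = x then f x else \<zero>\<^bsub>self_module R\<^esub>)
          = \<zero>\<^bsub>self_module R\<^esub>"
        by (intro K.M.add.finprod_one_eqI) auto
      with True show ?thesis
        by (simp add: self_module_def)
    next
      case False
      then show ?thesis
        using y fin by (intro K.M.add.finprod_singleton) (auto simp: self_module_def coeff)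
    qed
    finally show ?thesis by simp
  qed
  then show ?thesis
    using f lift by (intro PiE_ext[of _ S "\<lambda>_. carrier R"]) (auto simp: simps)
qed

lemma span_free_basis:
  assumes R: "cring R"
  shows "module.span R (free_module R S) (free_basis R S ` S) = carrier (free_module R S)"
proof -
  interpret module R "free_module R S" by (rule free_module_module) fact
  have sub: "submodule R (span (free_basis R S ` S)) (free_module R S)"
    using free_basis_closed[OF R] by (intro span_is_submodule) auto
  have gen: "free_basis R S ` S \<subseteq> span (free_basis R S ` S)"
    using free_basis_closed[OF R] by (intro in_own_span) auto
  have "f \<in> span (free_basis R S ` S)" if f: "f \<in> carrier (free_module R S)" for f
  proof -
    have "free_lift R S (free_module R S) (free_basis R S) f \<in> span (free_basis R S ` S)"
      unfolding free_lift_def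
    proof (intro submodule_finsum_closed[OF sub] funcsetI)
      fix x assume "x \<in> {x \<in> S. f x \<noteq> \<zero>\<^bsub>R\<^esub>}"
      then show "f x \<odot>\<^bsub>free_module R S\<^esub> free_basis R S x \<in> span (free_basis R S ` S)"
        using f gen by (intro submodule.smult_closed[OF sub]) (auto simp: free_module_simps[OF R])
    qed
    then show ?thesis
      using free_module_expansion[OF R f] by simp
  qed
  then show ?thesis
    using submodule.subset[OF sub] by blast
qed

section \<open>Quotient modules\<close>

lemma submodule_abelian_subgroup:
  assumes "submodule R K M"
  shows "abelian_subgroup K M"
proof -
  interpret K: submodule R K M by fact
  interpret module R M by (rule K.module)
  have "\<ominus>\<^bsub>M\<^esub> x \<in> K" if "x \<in> K" for x
    using that K.subset K.smult_closed[of "\<ominus>\<^bsub>R\<^esub> \<one>\<^bsub>R\<^esub>" x] smult_minus_1[of x]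
    by (metis R.add.inv_closed R.one_closed subsetD)
  moreover have ne: "K \<noteq> {}"
    using K.zero_closed by blast
  ultimately show ?thesis
    using K.subset
    by (intro abelian_subgroupI3 additive_subgroup.intro M.abelian_group_axioms
        M.add.subgroupI) (auto simp flip: a_inv_def)
qed

lemma quotient_proj_mod_hom:
  assumes K: "submodule R K M"
  shows "mod_hom R M (quotient_module M K) (\<lambda>x. K +>\<^bsub>M\<^esub> x)"
proof -
  interpret K: submodule R K M by fact
  interpret module R M by (rule K.module)
  interpret abelian_subgroup K M by (rule submodule_abelian_subgroup) fact
  show ?thesis
  proof (rule mod_hom_surj_image)
    fix c x
    assume c: "c \<in> carrier R" and x: "x \<in> carrier M"
    \<comment> \<open>All representatives of the coset contribute the same coset to the union.\<close>
    have "K +>\<^bsub>M\<^esub> c \<odot>\<^bsub>M\<^esub> y = K +>\<^bsub>M\<^esub> c \<odot>\<^bsub>M\<^esub> x" if y: "y \<in> K +>\<^bsub>M\<^esub> x" for y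
    proof -
      from y obtain h where h: "h \<in> K" "y = h \<oplus>\<^bsub>M\<^esub> x"
        by (auto simp: a_r_coset_def')
      then have "c \<odot>\<^bsub>M\<^esub> y = c \<odot>\<^bsub>M\<^esub> h \<oplus>\<^bsub>M\<^esub> c \<odot>\<^bsub>M\<^esub> x"
        using c x by (auto simp: smult_r_distr)
      then have "c \<odot>\<^bsub>M\<^esub> y \<in> K +>\<^bsub>M\<^esub> c \<odot>\<^bsub>M\<^esub> x"
        using c h by (auto simp: a_r_coset_def')
      then show ?thesis
        using a_repr_independence' c x by simp
    qed
    then have "(\<Union>y\<in>K +>\<^bsub>M\<^esub> x. K +>\<^bsub>M\<^esub> c \<odot>\<^bsub>M\<^esub> y) = K +>\<^bsub>M\<^esub> c \<odot>\<^bsub>M\<^esub> x"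
      using a_rcos_self[OF x] by blast
    then show "c \<odot>\<^bsub>quotient_module M K\<^esub> (K +>\<^bsub>M\<^esub> x) = K +>\<^bsub>M\<^esub> c \<odot>\<^bsub>M\<^esub> x"
      by (simp add: quotient_module_def)
  qed (auto simp: quotient_module_def A_RCOSETS_def' a_rcos_sum a_rcos_const intro: K.module)
qed

lemma carrier_quotient_module: "carrier (quotient_module M K) = (\<lambda>x. K +>\<^bsub>M\<^esub> x) ` carrier M"
  by (auto simp: quotient_module_def A_RCOSETS_def')

lemma coset_eqI:
  assumes K: "submodule R K M" and "x \<in> carrier M" "y \<in> carrier M" "x \<ominus>\<^bsub>M\<^esub> y \<in> K"
  shows "K +>\<^bsub>M\<^esub> x = K +>\<^bsub>M\<^esub> y"
proof -
  interpret abelian_subgroup K M by (rule submodule_abelian_subgroup[OF K])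
  show ?thesis
    using assms by (intro a_repr_independence'[symmetric] a_rcos_module_rev) (auto simp: a_minus_def)
qed

lemma mod_hom_of_comp_surj:
  assumes p: "mod_hom R M Q p" and surj: "carrier Q = p ` carrier M"
    and P: "module R P" and f: "mod_hom R M P (\<lambda>x. f (p x))"
  shows "mod_hom R Q P f"
proof -
  interpret p: mod_hom R M Q p by fact
  interpret f: mod_hom R M P "\<lambda>x. f (p x)" by fact
  show ?thesis
  proof (rule mod_homI)
    fix x y assume "x \<in> carrier Q" "y \<in> carrier Q"
    then show "f (x \<oplus>\<^bsub>Q\<^esub> y) = f x \<oplus>\<^bsub>P\<^esub> f y"
      using f.f_add p.f_add unfolding surj by (metis (no_types, lifting) imageE)
  next
    fix c x assume "c \<in> carrier R" "x \<in> carrier Q"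
    then show "f (c \<odot>\<^bsub>Q\<^esub> x) = c \<odot>\<^bsub>P\<^esub> f x"
      using f.f_smult p.f_smult unfolding surj by (metis (no_types, lifting) imageE)
  qed (use f.f_im in \<open>auto simp: surj intro: P p.N.module_axioms\<close>)
qed

section \<open>Tensor products\<close>

text \<open>
  The module conditions are listed separately, since the other two conditions are vacuous when both
  carriers are empty.
\<close>

definition bilinear_map ::
  "('r, 'd) ring_scheme \<Rightarrow> ('r, 'm, 'e) module_scheme \<Rightarrow> ('r, 'n, 'f) module_scheme
     \<Rightarrow> ('r, 'p, 'g) module_scheme \<Rightarrow> ('m \<Rightarrow> 'n \<Rightarrow> 'p) \<Rightarrow> bool" where
  "bilinear_map R M N P \<beta> \<longleftrightarrow> module R M \<and> module R N \<and> module R P \<and>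
     (\<forall>n \<in> carrier N. mod_hom R M P (\<lambda>m. \<beta> m n)) \<and> (\<forall>m \<in> carrier M. mod_hom R N P (\<beta> m))"

lemma bilinear_mapD:
  assumes "bilinear_map R M N P \<beta>"
  shows "module R M" "module R N" "module R P"
    and "n \<in> carrier N \<Longrightarrow> mod_hom R M P (\<lambda>m. \<beta> m n)"
    and "m \<in> carrier M \<Longrightarrow> mod_hom R N P (\<beta> m)"
  using assms by (auto simp: bilinear_map_def)

lemma bilinear_map_comp:
  assumes \<beta>: "bilinear_map R M' N' P \<beta>" and f: "mod_hom R M M' f" and g: "mod_hom R N N' g"
  shows "bilinear_map R M N P (\<lambda>m n. \<beta> (f m) (g n))"
  unfolding bilinear_map_def
proof (intro conjI ballI)
  show "mod_hom R M P (\<lambda>m. \<beta> (f m) (g n))" if "n \<in> carrier N" for n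
    using mod_hom_comp[OF f bilinear_mapD(4)[OF \<beta> mod_hom.f_im[OF g that]]] .
  show "mod_hom R N P (\<lambda>n. \<beta> (f m) (g n))" if "m \<in> carrier M" for m
    using mod_hom_comp[OF g bilinear_mapD(5)[OF \<beta> mod_hom.f_im[OF f that]]] .
qed (rule mod_hom_modules(1)[OF f] mod_hom_modules(1)[OF g] bilinear_mapD(3)[OF \<beta>])+

lemma bilinear_map_flip:
  assumes \<beta>: "bilinear_map R M N P \<beta>"
  shows "bilinear_map R N M P (\<lambda>n m. \<beta> m n)"
  using assms by (auto simp: bilinear_map_def)

context
  fixes R :: "('r, 'd) ring_scheme" and M :: "('r, 'm, 'e) module_scheme"
    and N :: "('r, 'n, 'f) module_scheme"
  assumes M: "module R M" and N: "module R N"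
begin

interpretation M: module R M by (rule M)
interpretation N: module R N by (rule N)

abbreviation (input) "pairs \<equiv> carrier M \<times> carrier N"

lemma tensor_relations_subset: "tensor_relations R M N \<subseteq> carrier (free_module R pairs)"
proof -
  interpret F: module R "free_module R pairs" by (rule free_module_module) (rule M.R.is_cring)
  have \<delta>: "free_basis R pairs p \<in> carrier (free_module R pairs)" if "p \<in> pairs" for p
    using that by (rule free_basis_closed[OF M.R.is_cring])
  show ?thesis
    unfolding tensor_relations_def Let_def
    by (intro Un_least subsetI; elim CollectE exE conjE; hypsubst;
        intro F.M.minus_closed F.M.add.m_closed F.smult_closed \<delta>; simp)
qed

lemma tensor_kernel_submodule:
  "submodule R (tensor_kernel R M N) (free_module R pairs)"
  unfolding tensor_kernel_def
  by (rule module.span_is_submodule[OF free_module_module[OF M.R.is_cring] tensor_relations_subset])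

lemma tensor_relations_subset_kernel: "tensor_relations R M N \<subseteq> tensor_kernel R M N"
  unfolding tensor_kernel_def
  by (rule module.in_own_span[OF free_module_module[OF M.R.is_cring] tensor_relations_subset])

lemma tensor_proj_mod_hom:
  "mod_hom R (free_module R pairs) (tensor_product R M N)
     (\<lambda>f. tensor_kernel R M N +>\<^bsub>free_module R pairs\<^esub> f)"
  unfolding tensor_product_def by (rule quotient_proj_mod_hom[OF tensor_kernel_submodule])

lemma carrier_tensor_product:
  "carrier (tensor_product R M N)
     = (\<lambda>f. tensor_kernel R M N +>\<^bsub>free_module R pairs\<^esub> f) ` carrier (free_module R pairs)"
  unfolding tensor_product_def by (rule carrier_quotient_module)

lemma tensor_product_module: "module R (tensor_product R M N)"
  using tensor_proj_mod_hom by (rule mod_hom_modules)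

text \<open>
  Each of the four bilinearity laws is the vanishing of one of the four families of defining
  relations in the quotient.
\<close>

lemma tensor_bilinear: "bilinear_map R M N (tensor_product R M N) (tensor R M N)"
proof -
  let ?F = "free_module R pairs" and ?T = "tensor_product R M N"
  let ?p = "\<lambda>f. tensor_kernel R M N +>\<^bsub>?F\<^esub> f" and ?\<delta> = "free_basis R pairs"
  interpret p: mod_hom R ?F ?T ?p by (rule tensor_proj_mod_hom)
  have \<delta>: "?\<delta> q \<in> carrier ?F" if "q \<in> pairs" for q
    using that by (rule free_basis_closed[OF M.R.is_cring])
  have rel: "?p f = ?p g" if "f \<ominus>\<^bsub>?F\<^esub> g \<in> tensor_relations R M N" "f \<in> carrier ?F" "g \<in> carrier ?F"
    for f g
    using that tensor_relations_subset_kernel by (intro coset_eqI[OF tensor_kernel_submodule]) auto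
  have closed: "tensor R M N m n \<in> carrier ?T" if "m \<in> carrier M" "n \<in> carrier N" for m n
    unfolding tensor_def using that by (intro p.f_im \<delta>) simp
  have "tensor R M N (m \<oplus>\<^bsub>M\<^esub> m') n = tensor R M N m n \<oplus>\<^bsub>?T\<^esub> tensor R M N m' n"
    if m: "m \<in> carrier M" "m' \<in> carrier M" and n: "n \<in> carrier N" for m m' n
  proof -
    have "?\<delta> (m \<oplus>\<^bsub>M\<^esub> m', n) \<ominus>\<^bsub>?F\<^esub> (?\<delta> (m, n) \<oplus>\<^bsub>?F\<^esub> ?\<delta> (m', n)) \<in> tensor_relations R M N"
      unfolding tensor_relations_def Let_def using m n by blast
    then have "?p (?\<delta> (m \<oplus>\<^bsub>M\<^esub> m', n)) = ?p (?\<delta> (m, n) \<oplus>\<^bsub>?F\<^esub> ?\<delta> (m', n))"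
      using m n by (intro rel p.M.M.add.m_closed \<delta>) auto
    then show ?thesis
      using m n by (simp add: tensor_def \<delta>)
  qed
  moreover have "tensor R M N m (n \<oplus>\<^bsub>N\<^esub> n') = tensor R M N m n \<oplus>\<^bsub>?T\<^esub> tensor R M N m n'"
    if m: "m \<in> carrier M" and n: "n \<in> carrier N" "n' \<in> carrier N" for m n n'
  proof -
    have "?\<delta> (m, n \<oplus>\<^bsub>N\<^esub> n') \<ominus>\<^bsub>?F\<^esub> (?\<delta> (m, n) \<oplus>\<^bsub>?F\<^esub> ?\<delta> (m, n')) \<in> tensor_relations R M N"
      unfolding tensor_relations_def Let_def using m n by blast
    then have "?p (?\<delta> (m, n \<oplus>\<^bsub>N\<^esub> n')) = ?p (?\<delta> (m, n) \<oplus>\<^bsub>?F\<^esub> ?\<delta> (m, n'))"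
      using m n by (intro rel p.M.M.add.m_closed \<delta>) auto
    then show ?thesis
      using m n by (simp add: tensor_def \<delta>)
  qed
  moreover have "tensor R M N (c \<odot>\<^bsub>M\<^esub> m) n = c \<odot>\<^bsub>?T\<^esub> tensor R M N m n"
    if c: "c \<in> carrier R" and m: "m \<in> carrier M" and n: "n \<in> carrier N" for c m n
  proof -
    have "?\<delta> (c \<odot>\<^bsub>M\<^esub> m, n) \<ominus>\<^bsub>?F\<^esub> c \<odot>\<^bsub>?F\<^esub> ?\<delta> (m, n) \<in> tensor_relations R M N"
      unfolding tensor_relations_def Let_def using c m n by blast
    then have "?p (?\<delta> (c \<odot>\<^bsub>M\<^esub> m, n)) = ?p (c \<odot>\<^bsub>?F\<^esub> ?\<delta> (m, n))"
      using c m n by (intro rel p.M.smult_closed \<delta>) auto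
    then show ?thesis
      using c m n by (simp add: tensor_def \<delta>)
  qed
  moreover have "tensor R M N m (c \<odot>\<^bsub>N\<^esub> n) = c \<odot>\<^bsub>?T\<^esub> tensor R M N m n"
    if c: "c \<in> carrier R" and m: "m \<in> carrier M" and n: "n \<in> carrier N" for c m n
  proof -
    have "?\<delta> (m, c \<odot>\<^bsub>N\<^esub> n) \<ominus>\<^bsub>?F\<^esub> c \<odot>\<^bsub>?F\<^esub> ?\<delta> (m, n) \<in> tensor_relations R M N"
      unfolding tensor_relations_def Let_def using c m n by blast
    then have "?p (?\<delta> (m, c \<odot>\<^bsub>N\<^esub> n)) = ?p (c \<odot>\<^bsub>?F\<^esub> ?\<delta> (m, n))"
      using c m n by (intro rel p.M.smult_closed \<delta>) auto
    then show ?thesis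
      using c m n by (simp add: tensor_def \<delta>)
  qed
  ultimately show ?thesis
    unfolding bilinear_map_def using closed
    by (auto intro!: mod_homI M N tensor_product_module)
qed

text \<open>
  Freeze one factor at a time: for \<open>g \<in> G\<close> the elements \<open>n\<close> with \<open>g \<otimes> n\<close> in the span form a
  submodule containing \<open>H\<close>, hence everything; then for any \<open>n\<close> the elements \<open>m\<close> with \<open>m \<otimes> n\<close> in
  the span form a submodule containing \<open>G\<close>. So all pure tensors lie in the span, and these are the
  images of the basis of the free module.
\<close>

lemma span_pure_tensors:
  assumes G: "G \<subseteq> carrier M" "module.span R M G = carrier M"
    and H: "H \<subseteq> carrier N" "module.span R N H = carrier N"
  shows "module.span R (tensor_product R M N) {tensor R M N g h | g h. g \<in> G \<and> h \<in> H}
           = carrier (tensor_product R M N)"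
proof -
  let ?T = "tensor_product R M N"
  interpret T: module R ?T by (rule tensor_product_module)
  let ?P = "{tensor R M N g h | g h. g \<in> G \<and> h \<in> H}"
  let ?K = "T.span ?P"
  have hom_l: "mod_hom R M ?T (\<lambda>m. tensor R M N m n)" if "n \<in> carrier N" for n
    using tensor_bilinear that by (simp add: bilinear_map_def)
  have hom_r: "mod_hom R N ?T (tensor R M N m)" if "m \<in> carrier M" for m
    using tensor_bilinear that by (simp add: bilinear_map_def)
  have closed: "tensor R M N m n \<in> carrier ?T" if "m \<in> carrier M" "n \<in> carrier N" for m n
    using mod_hom.f_im[OF hom_r] that by blast
  have P: "?P \<subseteq> carrier ?T"
    using G(1) H(1) closed by blast
  have K: "submodule R ?K ?T"
    using P by (rule T.span_is_submodule)
  have PK: "?P \<subseteq> ?K"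
    using P by (rule T.in_own_span)
  have 1: "tensor R M N g n \<in> ?K" if g: "g \<in> G" and n: "n \<in> carrier N" for g n
  proof -
    have "g \<in> carrier M"
      using g G(1) by blast
    from submodule_vimage[OF hom_r[OF this] K]
    have "N.span H \<subseteq> {n \<in> carrier N. tensor R M N g n \<in> ?K}"
      by (rule span_subset_submodule) (use g H(1) PK in blast)
    then show ?thesis
      using n H(2) by blast
  qed
  have 2: "tensor R M N m n \<in> ?K" if m: "m \<in> carrier M" and n: "n \<in> carrier N" for m n
  proof -
    from submodule_vimage[OF hom_l[OF n] K]
    have "M.span G \<subseteq> {m \<in> carrier M. tensor R M N m n \<in> ?K}"
      by (rule span_subset_submodule) (use n G(1) 1 in blast)
    then show ?thesis
      using m G(2) by blast
  qed
  from submodule_vimage[OF tensor_proj_mod_hom K]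
  have "module.span R (free_module R pairs) (free_basis R pairs ` pairs)
      \<subseteq> {f \<in> carrier (free_module R pairs). tensor_kernel R M N +>\<^bsub>free_module R pairs\<^esub> f \<in> ?K}"
  proof (rule span_subset_submodule, intro image_subsetI CollectI conjI)
    fix p
    assume p: "p \<in> pairs"
    then show "free_basis R pairs p \<in> carrier (free_module R pairs)"
      by (rule free_basis_closed[OF M.R.is_cring])
    from p 2[of "fst p" "snd p"]
    show "tensor_kernel R M N +>\<^bsub>free_module R pairs\<^esub> free_basis R pairs p \<in> ?K"
      by (auto simp: tensor_def)
  qed
  then have "carrier ?T \<subseteq> ?K"
    unfolding span_free_basis[OF M.R.is_cring] carrier_tensor_product by blast
  then show ?thesis
    using submodule.subset[OF K] by blast
qed

text \<open>
  Bilinearity of \<open>\<beta>\<close> says that its linear extension to the free module kills the defining relations,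
  hence their span. So the extension is constant on cosets, and the image of a coset is the singleton
  that \<open>the_elem\<close> extracts.
\<close>

lemma tensor_lift_coset:
  assumes \<beta>: "bilinear_map R M N P \<beta>" and f: "f \<in> carrier (free_module R pairs)"
  shows "tensor_lift R M N P \<beta> (tensor_kernel R M N +>\<^bsub>free_module R pairs\<^esub> f)
           = free_lift R pairs P (\<lambda>(m, n). \<beta> m n) f"
proof -
  let ?F = "free_module R pairs" and ?\<delta> = "free_basis R pairs"
  define L where "L = free_lift R pairs P (\<lambda>(m, n). \<beta> m n)"
  have l: "mod_hom R M P (\<lambda>m. \<beta> m n)" if "n \<in> carrier N" for n
    using \<beta> that by (simp add: bilinear_map_def)
  have r: "mod_hom R N P (\<beta> m)" if "m \<in> carrier M" for m
    using \<beta> that by (simp add: bilinear_map_def)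
  have closed: "\<beta> m n \<in> carrier P" if "m \<in> carrier M" "n \<in> carrier N" for m n
    using mod_hom.f_im[OF r] that by blast
  have bilinear:
    "m \<in> carrier M \<Longrightarrow> m' \<in> carrier M \<Longrightarrow> n \<in> carrier N \<Longrightarrow> \<beta> (m \<oplus>\<^bsub>M\<^esub> m') n = \<beta> m n \<oplus>\<^bsub>P\<^esub> \<beta> m' n"
    "m \<in> carrier M \<Longrightarrow> n \<in> carrier N \<Longrightarrow> n' \<in> carrier N \<Longrightarrow> \<beta> m (n \<oplus>\<^bsub>N\<^esub> n') = \<beta> m n \<oplus>\<^bsub>P\<^esub> \<beta> m n'"
    "c \<in> carrier R \<Longrightarrow> m \<in> carrier M \<Longrightarrow> n \<in> carrier N \<Longrightarrow> \<beta> (c \<odot>\<^bsub>M\<^esub> m) n = c \<odot>\<^bsub>P\<^esub> \<beta> m n"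
    "c \<in> carrier R \<Longrightarrow> m \<in> carrier M \<Longrightarrow> n \<in> carrier N \<Longrightarrow> \<beta> m (c \<odot>\<^bsub>N\<^esub> n) = c \<odot>\<^bsub>P\<^esub> \<beta> m n" for m m' n n' c
    using mod_hom_map_add[OF l] mod_hom_map_add[OF r] mod_hom_map_smult[OF l] mod_hom_map_smult[OF r]
    by simp_all
  have P: "module R P"
    using \<beta> by (simp add: bilinear_map_def)
  interpret L: mod_hom R ?F P L
    unfolding L_def by (rule free_lift_mod_hom) (use closed P in auto)
  have \<delta>: "?\<delta> q \<in> carrier ?F" if "q \<in> pairs" for q
    using that by (rule free_basis_closed[OF M.R.is_cring])
  have L\<delta>: "L (?\<delta> (m, n)) = \<beta> m n" if "m \<in> carrier M" "n \<in> carrier N" for m n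
    unfolding L_def using that closed by (subst free_lift_basis[OF P]) auto
  have "tensor_relations R M N \<subseteq> {f \<in> carrier ?F. L f = \<zero>\<^bsub>P\<^esub>}"
  proof (intro subsetI CollectI conjI)
    fix x
    assume x: "x \<in> tensor_relations R M N"
    then show "x \<in> carrier ?F"
      using tensor_relations_subset by blast
    from x show "L x = \<zero>\<^bsub>P\<^esub>"
      unfolding tensor_relations_def Let_def
      by (elim UnE CollectE exE conjE)
        (simp_all add: \<delta> L\<delta> closed bilinear)
  qed
  moreover have "submodule R {f \<in> carrier ?F. L f = \<zero>\<^bsub>P\<^esub>} ?F"
    using L.ker_is_submodule by (simp add: L.ker_def)
  ultimately have ker: "tensor_kernel R M N \<subseteq> {f \<in> carrier ?F. L f = \<zero>\<^bsub>P\<^esub>}"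
    unfolding tensor_kernel_def by (intro span_subset_submodule)
  have "L g = L f" if "g \<in> tensor_kernel R M N +>\<^bsub>?F\<^esub> f" for g
    using that ker f by (auto simp: a_r_coset_def')
  moreover have "f \<in> tensor_kernel R M N +>\<^bsub>?F\<^esub> f"
    using abelian_subgroup.a_rcos_self[OF submodule_abelian_subgroup[OF tensor_kernel_submodule] f] .
  ultimately have "L ` (tensor_kernel R M N +>\<^bsub>?F\<^esub> f) = {L f}"
    by blast
  then show ?thesis
    unfolding tensor_lift_def L_def[symmetric] by simp
qed

lemma tensor_lift_mod_hom:
  assumes \<beta>: "bilinear_map R M N P \<beta>"
  shows "mod_hom R (tensor_product R M N) P (tensor_lift R M N P \<beta>)"
proof (rule mod_hom_of_comp_surj[OF tensor_proj_mod_hom carrier_tensor_product])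
  show P: "module R P"
    using \<beta> by (simp add: bilinear_map_def)
  have "\<beta> m n \<in> carrier P" if "m \<in> carrier M" "n \<in> carrier N" for m n
    using \<beta> that mod_hom.f_im[of R N P "\<beta> m" n] by (simp add: bilinear_map_def)
  then have "mod_hom R (free_module R pairs) P (free_lift R pairs P (\<lambda>(m, n). \<beta> m n))"
    by (intro free_lift_mod_hom P) auto
  then show "mod_hom R (free_module R pairs) P
      (\<lambda>f. tensor_lift R M N P \<beta> (tensor_kernel R M N +>\<^bsub>free_module R pairs\<^esub> f))"
    by (rule mod_hom_cong) (simp add: tensor_lift_coset[OF \<beta>])
qed

lemma tensor_lift_tensor:
  assumes \<beta>: "bilinear_map R M N P \<beta>" and m: "m \<in> carrier M" and n: "n \<in> carrier N"
  shows "tensor_lift R M N P \<beta> (tensor R M N m n) = \<beta> m n"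
proof -
  have "\<beta> m n \<in> carrier P" if "m \<in> carrier M" "n \<in> carrier N" for m n
    using \<beta> that mod_hom.f_im[of R N P "\<beta> m" n] by (simp add: bilinear_map_def)
  moreover have "module R P"
    using \<beta> by (simp add: bilinear_map_def)
  ultimately show ?thesis
    unfolding tensor_def using m n
    by (subst tensor_lift_coset[OF \<beta> free_basis_closed[OF M.R.is_cring]];
        (subst free_lift_basis)?) auto
qed

end

hide_const (open) pairs

lemma tensor_mod_hom:
  assumes "module R M" "module R N"
  shows "n \<in> carrier N \<Longrightarrow> mod_hom R M (tensor_product R M N) (\<lambda>m. tensor R M N m n)"
    and "m \<in> carrier M \<Longrightarrow> mod_hom R N (tensor_product R M N) (tensor R M N m)"
  using tensor_bilinear[OF assms] by (auto simp: bilinear_map_def)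

lemma tensor_closed:
  assumes "module R M" "module R N" "m \<in> carrier M" "n \<in> carrier N"
  shows "tensor R M N m n \<in> carrier (tensor_product R M N)"
  by (rule mod_hom.f_im[OF tensor_mod_hom(2)[OF assms(1-3)] assms(4)])

text \<open>
  The principle by which all identities of maps on tensor products are checked.
\<close>

lemma tensor_hom_eqI:
  assumes M: "module R M" and N: "module R N"
    and G: "G \<subseteq> carrier M" "module.span R M G = carrier M"
    and H: "H \<subseteq> carrier N" "module.span R N H = carrier N"
    and f: "mod_hom R (tensor_product R M N) P f" and g: "mod_hom R (tensor_product R M N) P g"
    and eq: "\<And>m n. m \<in> G \<Longrightarrow> n \<in> H \<Longrightarrow> f (tensor R M N m n) = g (tensor R M N m n)"
    and t: "t \<in> carrier (tensor_product R M N)"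
  shows "f t = g t"
proof (rule mod_hom_eq_on_span[OF f g])
  show "t \<in> module.span R (tensor_product R M N) {tensor R M N g h | g h. g \<in> G \<and> h \<in> H}"
    using t by (simp add: span_pure_tensors[OF M N G H])
  show "{tensor R M N g h | g h. g \<in> G \<and> h \<in> H} \<subseteq> carrier (tensor_product R M N)"
    using G(1) H(1) tensor_closed[OF M N] by blast
  show "f x = g x" if "x \<in> {tensor R M N g h | g h. g \<in> G \<and> h \<in> H}" for x
    using that eq by blast
qed

text \<open>
  For fixed \<open>t\<close>, both sides of the additivity law in \<open>a\<close> are linear in \<open>t\<close> and agree on pure
  tensors, and the same holds for scalars. This is needed to lift a trilinear map in two stages, as
  in the associativity isomorphisms.
\<close>

lemma tensor_lift_family_mod_hom:
  assumes A: "module R A"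
    and \<beta>: "\<And>a. a \<in> carrier A \<Longrightarrow> bilinear_map R M N P (\<beta> a)"
    and fam: "\<And>m n. m \<in> carrier M \<Longrightarrow> n \<in> carrier N \<Longrightarrow> mod_hom R A P (\<lambda>a. \<beta> a m n)"
    and t: "t \<in> carrier (tensor_product R M N)"
  shows "mod_hom R A P (\<lambda>a. tensor_lift R M N P (\<beta> a) t)"
proof -
  interpret A: module R A by fact
  note \<beta>0 = \<beta>[OF A.M.zero_closed]
  note M = bilinear_mapD(1)[OF \<beta>0] and N = bilinear_mapD(2)[OF \<beta>0] and P = bilinear_mapD(3)[OF \<beta>0]
  note eqI = tensor_hom_eqI[OF M N order_refl span_carrier[OF M] order_refl span_carrier[OF N] _ _ _ t]
  note lift = tensor_lift_mod_hom[OF M N \<beta>]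
  note val = tensor_lift_tensor[OF M N \<beta>]
  show ?thesis
  proof (rule mod_homI[OF A P])
    show "tensor_lift R M N P (\<beta> a) t \<in> carrier P" if "a \<in> carrier A" for a
      using mod_hom.f_im[OF lift[OF that] t] .
  next
    fix a b
    assume ab: "a \<in> carrier A" "b \<in> carrier A"
    show "tensor_lift R M N P (\<beta> (a \<oplus>\<^bsub>A\<^esub> b)) t
        = tensor_lift R M N P (\<beta> a) t \<oplus>\<^bsub>P\<^esub> tensor_lift R M N P (\<beta> b) t"
      by (rule eqI[where P = P and f = "tensor_lift R M N P (\<beta> (a \<oplus>\<^bsub>A\<^esub> b))"])
        (use ab in \<open>simp_all add: lift mod_hom_add val mod_hom_map_add[OF fam]\<close>)
  next
    fix c a
    assume ca: "c \<in> carrier R" "a \<in> carrier A"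
    show "tensor_lift R M N P (\<beta> (c \<odot>\<^bsub>A\<^esub> a)) t = c \<odot>\<^bsub>P\<^esub> tensor_lift R M N P (\<beta> a) t"
      by (rule eqI[where P = P and f = "tensor_lift R M N P (\<beta> (c \<odot>\<^bsub>A\<^esub> a))"])
        (use ca in \<open>simp_all add: lift mod_hom_smult val mod_hom_map_smult[OF fam]\<close>)
  qed
qed

subsection \<open>Induced maps and canonical isomorphisms\<close>

lemma tensor_map_bilinear:
  assumes f: "mod_hom R M M' f" and g: "mod_hom R N N' g"
  shows "bilinear_map R M N (tensor_product R M' N') (\<lambda>m n. tensor R M' N' (f m) (g n))"
  by (rule bilinear_map_comp[OF tensor_bilinear f g]) (rule mod_hom_modules(2)[OF f] mod_hom_modules(2)[OF g])+

lemma tensor_map_mod_hom: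
  assumes f: "mod_hom R M M' f" and g: "mod_hom R N N' g"
  shows "mod_hom R (tensor_product R M N) (tensor_product R M' N') (tensor_map R M N M' N' f g)"
  unfolding tensor_map_def
  by (rule tensor_lift_mod_hom[OF mod_hom_modules(1)[OF f] mod_hom_modules(1)[OF g]
        tensor_map_bilinear[OF f g]])

lemma tensor_map_tensor:
  assumes f: "mod_hom R M M' f" and g: "mod_hom R N N' g" and "m \<in> carrier M" "n \<in> carrier N"
  shows "tensor_map R M N M' N' f g (tensor R M N m n) = tensor R M' N' (f m) (g n)"
  unfolding tensor_map_def
  by (rule tensor_lift_tensor[OF mod_hom_modules(1)[OF f] mod_hom_modules(1)[OF g]
        tensor_map_bilinear[OF f g]]) fact+

lemma
  assumes M: "module R M" and N: "module R N"
  shows tensor_flip_mod_hom: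
      "mod_hom R (tensor_product R M N) (tensor_product R N M) (tensor_flip R M N)"
    and tensor_flip_tensor: "m \<in> carrier M \<Longrightarrow> n \<in> carrier N \<Longrightarrow>
      tensor_flip R M N (tensor R M N m n) = tensor R N M n m"
  unfolding tensor_flip_def
  using tensor_lift_mod_hom[OF M N bilinear_map_flip[OF tensor_bilinear[OF N M]]]
    tensor_lift_tensor[OF M N bilinear_map_flip[OF tensor_bilinear[OF N M]]]
  by auto

context
  fixes R :: "('r, 'd) ring_scheme" and A :: "('r, 'a, 'e) module_scheme"
    and B :: "('r, 'b, 'f) module_scheme" and C :: "('r, 'c, 'g) module_scheme"
  assumes A: "module R A" and B: "module R B" and C: "module R C"
begin

abbreviation (input) "AB \<equiv> tensor_product R A B"
abbreviation (input) "BC \<equiv> tensor_product R B C"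
abbreviation (input) "A_BC \<equiv> tensor_product R A BC"
abbreviation (input) "AB_C \<equiv> tensor_product R AB C"

lemma tensor_assoc_inner_bilinear:
  assumes c: "c \<in> carrier C"
  shows "bilinear_map R A B A_BC (\<lambda>a b. tensor R A BC a (tensor R B C b c))"
  using bilinear_map_comp[OF tensor_bilinear[OF A tensor_product_module[OF B C]] mod_hom_id[OF A] tensor_mod_hom(1)[OF B C c]]
  by simp

lemma tensor_assoc_bilinear:
  "bilinear_map R AB C A_BC
     (\<lambda>t c. tensor_lift R A B A_BC (\<lambda>a b. tensor R A BC a (tensor R B C b c)) t)"
  unfolding bilinear_map_def
proof (intro conjI ballI)
  show "mod_hom R AB A_BC (\<lambda>t. tensor_lift R A B A_BC (\<lambda>a b. tensor R A BC a (tensor R B C b c)) t)"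
    if "c \<in> carrier C" for c
    by (rule tensor_lift_mod_hom[OF A B tensor_assoc_inner_bilinear[OF that]])
  show "mod_hom R C A_BC (\<lambda>c. tensor_lift R A B A_BC (\<lambda>a b. tensor R A BC a (tensor R B C b c)) t)"
    if "t \<in> carrier AB" for t
    by (rule tensor_lift_family_mod_hom[OF C tensor_assoc_inner_bilinear _ that])
      (auto intro: mod_hom_comp[OF tensor_mod_hom(2)[OF B C] tensor_mod_hom(2)[OF A tensor_product_module[OF B C]]])
qed (rule tensor_product_module[OF A B] C tensor_product_module[OF A tensor_product_module[OF B C]])+

lemma tensor_assoc_mod_hom: "mod_hom R AB_C A_BC (tensor_assoc R A B C)"
  unfolding tensor_assoc_def Let_def
  by (rule tensor_lift_mod_hom[OF tensor_product_module[OF A B] C tensor_assoc_bilinear])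

lemma tensor_assoc_tensor:
  assumes a: "a \<in> carrier A" and b: "b \<in> carrier B" and c: "c \<in> carrier C"
  shows "tensor_assoc R A B C (tensor R AB C (tensor R A B a b) c)
           = tensor R A BC a (tensor R B C b c)"
  unfolding tensor_assoc_def Let_def
  by (simp add: tensor_lift_tensor[OF tensor_product_module[OF A B] C tensor_assoc_bilinear tensor_closed[OF A B a b] c]
      tensor_lift_tensor[OF A B tensor_assoc_inner_bilinear[OF c] a b])

lemma tensor_assoc_inv_inner_bilinear:
  assumes a: "a \<in> carrier A"
  shows "bilinear_map R B C AB_C (\<lambda>b c. tensor R AB C (tensor R A B a b) c)"
  using bilinear_map_comp[OF tensor_bilinear[OF tensor_product_module[OF A B] C] tensor_mod_hom(2)[OF A B a] mod_hom_id[OF C]]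
  by simp

lemma tensor_assoc_inv_bilinear:
  "bilinear_map R A BC AB_C
     (\<lambda>a t. tensor_lift R B C AB_C (\<lambda>b c. tensor R AB C (tensor R A B a b) c) t)"
  unfolding bilinear_map_def
proof (intro conjI ballI)
  show "mod_hom R BC AB_C (\<lambda>t. tensor_lift R B C AB_C (\<lambda>b c. tensor R AB C (tensor R A B a b) c) t)"
    if "a \<in> carrier A" for a
    by (rule tensor_lift_mod_hom[OF B C tensor_assoc_inv_inner_bilinear[OF that]])
  show "mod_hom R A AB_C (\<lambda>a. tensor_lift R B C AB_C (\<lambda>b c. tensor R AB C (tensor R A B a b) c) t)"
    if "t \<in> carrier BC" for t
    by (rule tensor_lift_family_mod_hom[OF A tensor_assoc_inv_inner_bilinear _ that])
      (auto intro: mod_hom_comp[OF tensor_mod_hom(1)[OF A B] tensor_mod_hom(1)[OF tensor_product_module[OF A B] C]])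
qed (rule A tensor_product_module[OF B C] tensor_product_module[OF tensor_product_module[OF A B] C])+

lemma tensor_assoc_inv_mod_hom: "mod_hom R A_BC AB_C (tensor_assoc_inv R A B C)"
  unfolding tensor_assoc_inv_def Let_def
  by (rule tensor_lift_mod_hom[OF A tensor_product_module[OF B C] tensor_assoc_inv_bilinear])

lemma tensor_assoc_inv_tensor:
  assumes a: "a \<in> carrier A" and b: "b \<in> carrier B" and c: "c \<in> carrier C"
  shows "tensor_assoc_inv R A B C (tensor R A BC a (tensor R B C b c))
           = tensor R AB C (tensor R A B a b) c"
  unfolding tensor_assoc_inv_def Let_def
  by (simp add: tensor_lift_tensor[OF A tensor_product_module[OF B C] tensor_assoc_inv_bilinear a tensor_closed[OF B C b c]]
      tensor_lift_tensor[OF B C tensor_assoc_inv_inner_bilinear[OF a] b c])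

end

hide_const (open) AB BC A_BC AB_C

text \<open>
  Each of the five factors of \<open>middle_flip\<close> is linear and sends pure tensors to pure tensors, so a
  pure tensor can be followed through the composite.
\<close>

lemma
  assumes C: "module R C"
  defines "CC \<equiv> tensor_product R C C"
  shows middle_flip_mod_hom:
      "mod_hom R (tensor_product R CC CC) (tensor_product R CC CC) (middle_flip R C)"
    and middle_flip_tensor: "\<lbrakk>a \<in> carrier C; b \<in> carrier C; c \<in> carrier C; d \<in> carrier C\<rbrakk> \<Longrightarrow>
      middle_flip R C (tensor R CC CC (tensor R C C a b) (tensor R C C c d))
        = tensor R CC CC (tensor R C C a c) (tensor R C C b d)"
proof -
  let ?C_CC = "tensor_product R C CC" and ?CC_C = "tensor_product R CC C"
  have CC: "module R CC"
    unfolding CC_def by (rule tensor_product_module[OF C C])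
  have C_CC: "module R ?C_CC" and CC_C: "module R ?CC_C"
    by (rule tensor_product_module[OF C CC] tensor_product_module[OF CC C])+
  note id = mod_hom_id[OF C]
  note flip = tensor_map_mod_hom[OF tensor_flip_mod_hom[OF C C] id, folded CC_def]
  note assoc = tensor_assoc_mod_hom[OF C C C, folded CC_def]
  note assoc_inv = tensor_assoc_inv_mod_hom[OF C C C, folded CC_def]
  have eq: "middle_flip R C = (\<lambda>t. tensor_assoc_inv R C C CC
      (tensor_map R C ?CC_C C ?C_CC id (tensor_assoc R C C C)
      (tensor_map R C ?CC_C C ?CC_C id (tensor_map R CC C CC C (tensor_flip R C C) id)
      (tensor_map R C ?C_CC C ?CC_C id (tensor_assoc_inv R C C C)
      (tensor_assoc R C C CC t)))))"
    by (simp add: middle_flip_def Let_def comp_def CC_def)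
  show "mod_hom R (tensor_product R CC CC) (tensor_product R CC CC) (middle_flip R C)"
    unfolding eq
    by (rule mod_hom_comp[OF mod_hom_comp[OF mod_hom_comp[OF mod_hom_comp]],
          OF tensor_assoc_mod_hom[OF C C CC, folded CC_def]
            tensor_map_mod_hom[OF id assoc_inv] tensor_map_mod_hom[OF id flip]
            tensor_map_mod_hom[OF id assoc]
            tensor_assoc_inv_mod_hom[OF C C CC, folded CC_def]])
  show "middle_flip R C (tensor R CC CC (tensor R C C a b) (tensor R C C c d))
        = tensor R CC CC (tensor R C C a c) (tensor R C C b d)"
    if [simp]: "a \<in> carrier C" "b \<in> carrier C" "c \<in> carrier C" "d \<in> carrier C"
  proof -
    have [simp]: "tensor R C C x y \<in> carrier CC" if "x \<in> carrier C" "y \<in> carrier C" for x y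
      unfolding CC_def using that by (rule tensor_closed[OF C C])
    have [simp]: "tensor R CC C u x \<in> carrier ?CC_C" "tensor R C CC x u \<in> carrier ?C_CC"
      if "x \<in> carrier C" "u \<in> carrier CC" for x u
      using that by (auto intro: tensor_closed C CC)
    show ?thesis
      unfolding eq
      by (simp add: tensor_assoc_tensor[OF C C CC, folded CC_def]
          tensor_map_tensor[OF id assoc_inv] tensor_assoc_inv_tensor[OF C C C, folded CC_def]
          tensor_map_tensor[OF id flip]
          tensor_map_tensor[OF tensor_flip_mod_hom[OF C C] id, folded CC_def]
          tensor_flip_tensor[OF C C] tensor_map_tensor[OF id assoc]
          tensor_assoc_tensor[OF C C C, folded CC_def]
          tensor_assoc_inv_tensor[OF C C CC, folded CC_def])
  qed
qed

section \<open>Coalgebras generated by grouplike elements\<close>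

lemma linear_map_iff_mod_hom:
  assumes "field R"
  shows "linear_map R M N f \<longleftrightarrow> mod_hom R M N f"
  using assms by (auto simp: linear_map_def vectorspace_def dest: mod_hom_modules)

text \<open>
  A linear comultiplication on a module that is generated by elements with \<open>\<Delta> g = g \<otimes> g\<close>. The
  axioms of coalgebras and of self-distributive maps then become statements about these generators.
\<close>

context
  fixes R :: "('r, 'd) ring_scheme" and C :: "('r, 'c, 'e) module_scheme"
    and \<Delta> :: "'c \<Rightarrow> ('c \<times> 'c \<Rightarrow> 'r) set" and G :: "'c set"
  assumes \<Delta>: "mod_hom R C (tensor_product R C C) \<Delta>"
    and G: "G \<subseteq> carrier C" "module.span R C G = carrier C"
    and grouplike: "\<And>g. g \<in> G \<Longrightarrow> \<Delta> g = tensor R C C g g"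
begin

abbreviation (input) "CC \<equiv> tensor_product R C C"

lemma coalgebra_of_grouplikes:
  assumes R: "field R" and \<epsilon>: "mod_hom R C (self_module R) \<epsilon>"
    and \<epsilon>_grouplike: "\<And>g. g \<in> G \<Longrightarrow> \<epsilon> g = \<one>\<^bsub>R\<^esub>"
  shows "coalgebra R C \<Delta> \<epsilon>"
proof -
  note C = mod_hom_modules(1)[OF \<Delta>] and CC = mod_hom_modules(2)[OF \<Delta>]
  let ?K = "self_module R"
  interpret C: module R C by (rule C)
  have K: "module R ?K"
    by (rule self_module_module) (rule C.R.is_cring)
  have Gc: "g \<in> carrier C" if "g \<in> G" for g
    using that G(1) by blast
  have one: "\<one>\<^bsub>R\<^esub> \<in> carrier ?K"
    by (simp add: self_module_def)
  note id = mod_hom_id[OF C]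
  note eqI = mod_hom_eq_on_span[where R = R and M = C, OF _ _ G(1), unfolded G(2)]
  have act: "bilinear_map R ?K C C (\<lambda>a x. a \<odot>\<^bsub>C\<^esub> x)"
    unfolding bilinear_map_def
  proof (intro conjI ballI K C)
    fix x assume "x \<in> carrier C"
    then show "mod_hom R ?K C (\<lambda>a. a \<odot>\<^bsub>C\<^esub> x)"
      by (intro mod_homI K C) (auto simp: self_module_def C.smult_l_distr C.smult_assoc1)
  next
    fix a assume "a \<in> carrier ?K"
    then show "mod_hom R C C (\<lambda>x. a \<odot>\<^bsub>C\<^esub> x)"
      using mod_hom_smult[OF id, of a] by (simp add: self_module_def)
  qed
  have coassoc: "tensor_assoc R C C C (tensor_map R C C CC C \<Delta> id (\<Delta> c))
      = tensor_map R C C C CC id \<Delta> (\<Delta> c)" if "c \<in> carrier C" for c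
    by (rule eqI[OF mod_hom_comp[OF \<Delta> mod_hom_comp[OF tensor_map_mod_hom[OF \<Delta> id]
              tensor_assoc_mod_hom[OF C C C]]]
            mod_hom_comp[OF \<Delta> tensor_map_mod_hom[OF id \<Delta>]] _ that])
      (simp add: grouplike Gc tensor_map_tensor[OF \<Delta> id] tensor_map_tensor[OF id \<Delta>]
        tensor_assoc_tensor[OF C C C])
  have counit_l: "tensor_lift R ?K C C (\<lambda>a x. a \<odot>\<^bsub>C\<^esub> x) (tensor_map R C C ?K C \<epsilon> id (\<Delta> c)) = id c"
    if "c \<in> carrier C" for c
    by (rule eqI[OF mod_hom_comp[OF \<Delta> mod_hom_comp[OF tensor_map_mod_hom[OF \<epsilon> id]
              tensor_lift_mod_hom[OF K C act]]] id _ that])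
      (simp add: grouplike Gc one tensor_map_tensor[OF \<epsilon> id] \<epsilon>_grouplike
        tensor_lift_tensor[OF K C act])
  have counit_r: "tensor_lift R C ?K C (\<lambda>x a. a \<odot>\<^bsub>C\<^esub> x) (tensor_map R C C C ?K id \<epsilon> (\<Delta> c)) = id c"
    if "c \<in> carrier C" for c
    by (rule eqI[OF mod_hom_comp[OF \<Delta> mod_hom_comp[OF tensor_map_mod_hom[OF id \<epsilon>]
              tensor_lift_mod_hom[OF C K bilinear_map_flip[OF act]]]] id _ that])
      (simp add: grouplike Gc one tensor_map_tensor[OF id \<epsilon>] \<epsilon>_grouplike
        tensor_lift_tensor[OF C K bilinear_map_flip[OF act]])
  show ?thesis
    unfolding coalgebra_def Let_def linear_map_iff_mod_hom[OF R]
    using \<Delta> \<epsilon> coassoc counit_l counit_r by simp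
qed

context
  fixes q :: "('c \<times> 'c \<Rightarrow> 'r) set \<Rightarrow> 'c"
  assumes q: "mod_hom R CC C q"
begin

text \<open>
  On \<open>g \<otimes> h\<close> compatibility reads \<open>\<Delta> x = x \<otimes> x\<close> for \<open>x = q (g \<otimes> h)\<close>. This holds for the
  generators, and also for \<open>x = 0\<close>.
\<close>

lemma comult_compatible_of_grouplikes:
  assumes "\<And>g h. g \<in> G \<Longrightarrow> h \<in> G \<Longrightarrow> q (tensor R C C g h) \<in> insert \<zero>\<^bsub>C\<^esub> G"
  shows "comult_compatible R C \<Delta> q"
  unfolding comult_compatible_def Let_def comp_def
proof
  note C = mod_hom_modules(1)[OF \<Delta>] and CC = mod_hom_modules(2)[OF \<Delta>]
  fix t
  assume t: "t \<in> carrier CC"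
  have grouplike': "\<Delta> x = tensor R C C x x" if "x \<in> insert \<zero>\<^bsub>C\<^esub> G" for x
  proof (cases "x = \<zero>\<^bsub>C\<^esub>")
    case True
    have zero: "\<zero>\<^bsub>C\<^esub> \<in> carrier C"
      using C by (simp add: module_def abelian_group_def abelian_monoid.zero_closed)
    show ?thesis
      using True mod_hom.f0_is_0[OF \<Delta>] mod_hom.f0_is_0[OF tensor_mod_hom(2)[OF C C zero]] by simp
  qed (use that grouplike in auto)
  have cl: "tensor R C C g h \<in> carrier CC" if "g \<in> carrier C" "h \<in> carrier C" for g h
    using that by (rule tensor_closed[OF C C])
  have Gc: "g \<in> carrier C" if "g \<in> G" for g
    using that G(1) by blast
  show "\<Delta> (q t) = tensor_map R CC CC C C q q (middle_flip R C (tensor_map R C C CC CC \<Delta> \<Delta> t))"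
    by (rule tensor_hom_eqI[OF C C G G mod_hom_comp[OF q \<Delta>]
          mod_hom_comp[OF tensor_map_mod_hom[OF \<Delta> \<Delta>]
            mod_hom_comp[OF middle_flip_mod_hom[OF C] tensor_map_mod_hom[OF q q]]] _ t])
      (simp add: Gc cl tensor_map_tensor[OF \<Delta> \<Delta>] grouplike middle_flip_tensor[OF C]
        tensor_map_tensor[OF q q] grouplike'[OF assms])
qed

text \<open>
  On \<open>(a \<otimes> b) \<otimes> c\<close> the comultiplication duplicates \<open>c\<close> and the middle flip distributes the two
  copies, giving \<open>(a \<otimes> c) \<otimes> (b \<otimes> c)\<close>.
\<close>

lemma self_distributive_of_grouplikes:
  assumes "\<And>a b c. a \<in> G \<Longrightarrow> b \<in> G \<Longrightarrow> c \<in> G \<Longrightarrow>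
    q (tensor R C C (q (tensor R C C a b)) c)
      = q (tensor R C C (q (tensor R C C a c)) (q (tensor R C C b c)))"
  shows "self_distributive R C \<Delta> q"
  unfolding self_distributive_def Let_def comp_def
proof
  note C = mod_hom_modules(1)[OF \<Delta>] and CC = mod_hom_modules(2)[OF \<Delta>]
  fix t
  assume t: "t \<in> carrier (tensor_product R CC C)"
  have cl: "tensor R C C g h \<in> carrier CC" if "g \<in> carrier C" "h \<in> carrier C" for g h
    using that by (rule tensor_closed[OF C C])
  have Gc: "g \<in> carrier C" if "g \<in> G" for g
    using that G(1) by blast
  note id = mod_hom_id[OF C]
  note id2 = tensor_map_mod_hom[OF id id]
  let ?H = "{tensor R C C g h | g h. g \<in> G \<and> h \<in> G}"
  have H: "?H \<subseteq> carrier CC"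
    using cl Gc by blast
  have eq: "q (tensor_map R CC C C C q id (tensor R CC C h c))
      = q (tensor_map R CC CC C C q q (middle_flip R C
          (tensor_map R CC C CC CC (tensor_map R C C C C id id) \<Delta> (tensor R CC C h c))))"
    if h: "h \<in> ?H" and c: "c \<in> G" for h c
  proof -
    from h obtain a b where h: "h = tensor R C C a b" and ab: "a \<in> G" "b \<in> G"
      by blast
    show ?thesis
      unfolding h using ab c
      by (simp add: Gc cl tensor_map_tensor[OF q id] tensor_map_tensor[OF id2 \<Delta>]
          tensor_map_tensor[OF id id] grouplike middle_flip_tensor[OF C] tensor_map_tensor[OF q q]
          assms)
  qed
  show "q (tensor_map R CC C C C q id t)
      = q (tensor_map R CC CC C C q q (middle_flip R C
          (tensor_map R CC C CC CC (tensor_map R C C C C id id) \<Delta> t)))"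
    by (rule tensor_hom_eqI[OF CC C H span_pure_tensors[OF C C G G] G
          mod_hom_comp[OF tensor_map_mod_hom[OF q id] q]
          mod_hom_comp[OF tensor_map_mod_hom[OF id2 \<Delta>]
            mod_hom_comp[OF middle_flip_mod_hom[OF C] mod_hom_comp[OF tensor_map_mod_hom[OF q q] q]]]
          eq t])
qed

end

end

hide_const (open) CC

section \<open>The coalgebra of a rack\<close>

lemma (in abelian_monoid) finsum_Times:
  assumes A: "finite A" and B: "finite B" and f: "f \<in> A \<times> B \<rightarrow> carrier G"
  shows "(\<Oplus>\<^bsub>G\<^esub>p\<in>A \<times> B. f p) = (\<Oplus>\<^bsub>G\<^esub>a\<in>A. \<Oplus>\<^bsub>G\<^esub>b\<in>B. f (a, b))"
  using A f
proof (induction A rule: finite_induct)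
  case (insert a A)
  have eq: "insert a A \<times> B = Pair a ` B \<union> A \<times> B"
    by auto
  have "(\<Oplus>\<^bsub>G\<^esub>p\<in>insert a A \<times> B. f p) = (\<Oplus>\<^bsub>G\<^esub>p\<in>Pair a ` B. f p) \<oplus> (\<Oplus>\<^bsub>G\<^esub>p\<in>A \<times> B. f p)"
    unfolding eq using insert B by (intro finsum_Un_disjoint) auto
  moreover have "(\<Oplus>\<^bsub>G\<^esub>p\<in>Pair a ` B. f p) = (\<Oplus>\<^bsub>G\<^esub>b\<in>B. f (a, b))"
    using insert.prems by (intro finsum_reindex) (auto simp: inj_on_def)
  moreover have "(\<Oplus>\<^bsub>G\<^esub>a\<in>insert a A. \<Oplus>\<^bsub>G\<^esub>b\<in>B. f (a, b))
      = (\<Oplus>\<^bsub>G\<^esub>b\<in>B. f (a, b)) \<oplus> (\<Oplus>\<^bsub>G\<^esub>a\<in>A. \<Oplus>\<^bsub>G\<^esub>b\<in>B. f (a, b))"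
    using insert by (intro finsum_insert) (auto intro!: finsum_closed)
  moreover have "(\<Oplus>\<^bsub>G\<^esub>p\<in>A \<times> B. f p) = (\<Oplus>\<^bsub>G\<^esub>a\<in>A. \<Oplus>\<^bsub>G\<^esub>b\<in>B. f (a, b))"
    using insert.prems by (intro insert.IH) auto
  ultimately show ?case
    by simp
qed simp

context
  fixes k :: "('r, 'd) ring_scheme" and X :: "'x set"
  assumes k: "cring k"
begin

interpretation k: cring k by (rule k)

abbreviation (input) "K \<equiv> self_module k"
abbreviation (input) "F \<equiv> free_module k X"
abbreviation (input) "W \<equiv> rack_space k X"
abbreviation (input) "e \<equiv> rack_unit k X"
abbreviation (input) "\<iota> \<equiv> rack_elem k X"

interpretation K: module k K by (rule self_module_module[OF k])
interpretation F: module k F by (rule free_module_module[OF k])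

lemma rack_space_module: "module k W"
  unfolding rack_space_def by (rule direct_sum_is_module[OF K.module_axioms F.module_axioms])

lemma rack_space_inj1: "mod_hom k K W (\<lambda>a. (a, \<zero>\<^bsub>F\<^esub>))"
  using inj1_hom[OF K.module_axioms F.module_axioms] by (simp add: rack_space_def inj1_def)

lemma rack_space_inj2: "mod_hom k F W (\<lambda>f. (\<zero>\<^bsub>k\<^esub>, f))"
  using inj2_hom[OF K.module_axioms F.module_axioms]
  by (simp add: rack_space_def inj2_def self_module_def)

lemma rack_space_fst: "mod_hom k W K fst"
  by (intro mod_homI rack_space_module K.module_axioms) (auto simp: rack_space_def direct_sum_def)

lemma rack_space_snd: "mod_hom k W F snd"
  by (intro mod_homI rack_space_module F.module_axioms) (auto simp: rack_space_def direct_sum_def)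

lemma rack_unit_eq: "e = (\<one>\<^bsub>k\<^esub>, \<zero>\<^bsub>F\<^esub>)"
  by (simp add: rack_unit_def inj1_def)

lemma rack_elem_eq: "\<iota> x = (\<zero>\<^bsub>k\<^esub>, free_basis k X x)"
  by (simp add: rack_elem_def inj2_def self_module_def)

lemma rack_unit_closed: "e \<in> carrier W"
  unfolding rack_unit_eq by (rule mod_hom.f_im[OF rack_space_inj1]) (simp add: self_module_def)

lemma rack_elem_closed: "x \<in> X \<Longrightarrow> \<iota> x \<in> carrier W"
  unfolding rack_elem_eq by (rule mod_hom.f_im[OF rack_space_inj2]) (rule free_basis_closed[OF k])

lemma span_rack_space: "module.span k W (insert e (\<iota> ` X)) = carrier W"
proof -
  interpret W: module k W by (rule rack_space_module)
  let ?G = "insert e (\<iota> ` X)"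
  have G: "?G \<subseteq> carrier W"
    using rack_unit_closed rack_elem_closed by auto
  have S: "submodule k (W.span ?G) W"
    using G by (rule W.span_is_submodule)
  have GS: "?G \<subseteq> W.span ?G"
    using G by (rule W.in_own_span)
  have "module.span k F (free_basis k X ` X) \<subseteq> {f \<in> carrier F. (\<zero>\<^bsub>k\<^esub>, f) \<in> W.span ?G}"
  proof (rule span_subset_submodule[OF submodule_vimage[OF rack_space_inj2 S]],
      intro image_subsetI CollectI conjI)
    fix x assume x: "x \<in> X"
    then show "free_basis k X x \<in> carrier F"
      by (rule free_basis_closed[OF k])
    show "(\<zero>\<^bsub>k\<^esub>, free_basis k X x) \<in> W.span ?G"
      using x GS unfolding rack_elem_eq by blast
  qed
  then have kX: "(\<zero>\<^bsub>k\<^esub>, f) \<in> W.span ?G" if "f \<in> carrier F" for f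
    using that unfolding span_free_basis[OF k] by blast
  have "w \<in> W.span ?G" if w: "w \<in> carrier W" for w
  proof -
    obtain a f where af: "w = (a, f)" "a \<in> carrier k" "f \<in> carrier F"
      using w by (auto simp: rack_space_def direct_sum_def self_module_def)
    have "w = a \<odot>\<^bsub>W\<^esub> e \<oplus>\<^bsub>W\<^esub> (\<zero>\<^bsub>k\<^esub>, f)"
      using af by (simp add: rack_unit_eq) (simp add: rack_space_def direct_sum_def self_module_def)
    moreover have "a \<odot>\<^bsub>W\<^esub> e \<in> W.span ?G"
      using GS af(2) by (intro submodule.smult_closed[OF S]) auto
    ultimately show ?thesis
      using submodule.m_closed[OF S _ kX[OF af(3)]] by simp
  qed
  then show ?thesis
    using submodule.subset[OF S] by blast
qed

lemma rack_extend_mod_hom: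
  assumes P: "module k P" and u: "u \<in> carrier P" and \<phi>: "\<And>x. x \<in> X \<Longrightarrow> \<phi> x \<in> carrier P"
  shows "mod_hom k W P (rack_extend k X P u \<phi>)"
proof -
  interpret P: module k P by fact
  have "mod_hom k K P (\<lambda>a. a \<odot>\<^bsub>P\<^esub> u)"
    using u by (intro mod_homI K.module_axioms P)
      (auto simp: self_module_def P.smult_l_distr P.smult_assoc1)
  note mod_hom_add[OF mod_hom_comp[OF rack_space_fst this]
      mod_hom_comp[OF rack_space_snd free_lift_mod_hom[OF P \<phi>]]]
  then show ?thesis
    by (simp add: rack_extend_def[abs_def])
qed

lemma rack_extend_unit:
  assumes P: "module k P" and u: "u \<in> carrier P" and \<phi>: "\<And>x. x \<in> X \<Longrightarrow> \<phi> x \<in> carrier P"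
  shows "rack_extend k X P u \<phi> e = u"
proof -
  interpret P: module k P by fact
  have "free_lift k X P \<phi> \<zero>\<^bsub>F\<^esub> = \<zero>\<^bsub>P\<^esub>"
    by (rule mod_hom.f0_is_0[OF free_lift_mod_hom[OF P \<phi>]])
  then show ?thesis
    using u by (simp add: rack_extend_def rack_unit_eq)
qed

lemma rack_extend_elem:
  assumes P: "module k P" and u: "u \<in> carrier P" and \<phi>: "\<And>x. x \<in> X \<Longrightarrow> \<phi> x \<in> carrier P"
    and x: "x \<in> X"
  shows "rack_extend k X P u \<phi> (\<iota> x) = \<phi> x"
proof -
  interpret P: module k P by fact
  show ?thesis
    using u \<phi>[OF x] free_lift_basis[where \<phi> = \<phi>, OF P \<phi> x] by (simp add: rack_extend_def rack_elem_eq)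
qed

lemma rack_extend_family_mod_hom:
  assumes u: "mod_hom k A P u" and \<phi>: "\<And>x. x \<in> X \<Longrightarrow> mod_hom k A P (\<lambda>v. \<phi> v x)"
    and w: "w \<in> carrier W"
  shows "mod_hom k A P (\<lambda>v. rack_extend k X P (u v) (\<phi> v) w)"
proof -
  have fst: "fst w \<in> carrier k" and snd: "snd w \<in> carrier F"
    using w by (auto simp: rack_space_def direct_sum_def self_module_def)
  have "snd w x \<in> carrier k" if "x \<in> X" for x
    using that snd by (auto simp: free_module_simps[OF k])
  then have "mod_hom k A P (\<lambda>v. free_lift k X P (\<phi> v) (snd w))"
    unfolding free_lift_def
    by (intro mod_hom_finsum_family mod_hom_smult \<phi> mod_hom_modules[OF u]) auto
  then show ?thesis
    unfolding rack_extend_def by (intro mod_hom_add mod_hom_smult[OF u fst])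
qed

context
  fixes rop :: "'x \<Rightarrow> 'x \<Rightarrow> 'x"
  assumes rop: "\<And>x y. x \<in> X \<Longrightarrow> y \<in> X \<Longrightarrow> rop x y \<in> X"
begin

text \<open>
  The bilinear map behind \<open>q\<close>, written as a linear extension in the first argument of linear
  extensions in the second. In this form its bilinearity and its values on the basis follow from
  those of \<open>rack_extend\<close>; \<open>rack_form_eq\<close> recovers the explicit sums.
\<close>

definition rack_form :: "'r \<times> ('x \<Rightarrow> 'r) \<Rightarrow> 'r \<times> ('x \<Rightarrow> 'r) \<Rightarrow> 'r \<times> ('x \<Rightarrow> 'r)" where
  "rack_form w v = rack_extend k X W (rack_extend k X W \<zero>\<^bsub>W\<^esub> (\<lambda>y. e) v)
     (\<lambda>x. rack_extend k X W \<zero>\<^bsub>W\<^esub> (\<lambda>y. \<iota> (rop x y)) v) w"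

interpretation W: module k W by (rule rack_space_module)

lemma rack_form_inner_mod_hom:
  "mod_hom k W W (rack_extend k X W \<zero>\<^bsub>W\<^esub> (\<lambda>y. e))"
  "x \<in> X \<Longrightarrow> mod_hom k W W (rack_extend k X W \<zero>\<^bsub>W\<^esub> (\<lambda>y. \<iota> (rop x y)))"
  by (intro rack_extend_mod_hom rack_space_module W.M.zero_closed rack_unit_closed rack_elem_closed
      rop; assumption)+

lemma rack_form_bilinear: "bilinear_map k W W W rack_form"
  unfolding bilinear_map_def
proof (intro conjI ballI rack_space_module)
  show "mod_hom k W W (\<lambda>w. rack_form w v)" if v: "v \<in> carrier W" for v
    unfolding rack_form_def
    by (intro rack_extend_mod_hom rack_space_module
        mod_hom.f_im[OF rack_form_inner_mod_hom(1) v] mod_hom.f_im[OF rack_form_inner_mod_hom(2) v])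
  show "mod_hom k W W (rack_form w)" if w: "w \<in> carrier W" for w
    unfolding rack_form_def
    by (rule rack_extend_family_mod_hom[OF rack_form_inner_mod_hom(1) rack_form_inner_mod_hom(2) w])
qed

lemma rack_form_basis:
  shows "rack_form e e = \<zero>\<^bsub>W\<^esub>"
    and "x \<in> X \<Longrightarrow> rack_form e (\<iota> x) = e"
    and "x \<in> X \<Longrightarrow> rack_form (\<iota> x) e = \<zero>\<^bsub>W\<^esub>"
    and "x \<in> X \<Longrightarrow> y \<in> X \<Longrightarrow> rack_form (\<iota> x) (\<iota> y) = \<iota> (rop x y)"
proof -
  have cl: "rack_extend k X W \<zero>\<^bsub>W\<^esub> (\<lambda>y. e) v \<in> carrier W"
    "x \<in> X \<Longrightarrow> rack_extend k X W \<zero>\<^bsub>W\<^esub> (\<lambda>y. \<iota> (rop x y)) v \<in> carrier W"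
    if "v \<in> carrier W" for v x
    using that rack_form_inner_mod_hom by (auto intro: mod_hom.f_im)
  note simps = rack_form_def rack_extend_unit[OF rack_space_module]
    rack_extend_elem[OF rack_space_module] cl rack_unit_closed rack_elem_closed rop
  show "rack_form e e = \<zero>\<^bsub>W\<^esub>"
    by (simp add: simps)
  show "rack_form e (\<iota> x) = e" if "x \<in> X"
    using that by (simp add: simps)
  show "rack_form (\<iota> x) e = \<zero>\<^bsub>W\<^esub>" if "x \<in> X"
    using that by (simp add: simps)
  show "rack_form (\<iota> x) (\<iota> y) = \<iota> (rop x y)" if "x \<in> X" "y \<in> X"
    using that by (simp add: simps)
qed

text \<open>
  The inner extensions \<open>U\<close> (of \<open>y \<mapsto> 1\<close>) and \<open>V x\<close> (of \<open>y \<mapsto> x \<triangleleft> y\<close>) lie in \<open>k\<close> and \<open>kX\<close> respectively,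
  so each of them contributes to one component only. Applying the two projections termwise gives the
  component in \<open>k\<close> directly and the one in \<open>kX\<close> as an iterated sum.
\<close>

lemma rack_form_eq:
  assumes "(a, f) \<in> carrier W" and "(b, g) \<in> carrier W"
  shows "rack_form (a, f) (b, g) =
    (\<Oplus>\<^bsub>k\<^esub>y \<in> {y \<in> X. g y \<noteq> \<zero>\<^bsub>k\<^esub>}. a \<otimes>\<^bsub>k\<^esub> g y,
     \<Oplus>\<^bsub>F\<^esub>p \<in> {x \<in> X. f x \<noteq> \<zero>\<^bsub>k\<^esub>} \<times> {y \<in> X. g y \<noteq> \<zero>\<^bsub>k\<^esub>}.
       (f (fst p) \<otimes>\<^bsub>k\<^esub> g (snd p)) \<odot>\<^bsub>F\<^esub> free_basis k X (rop (fst p) (snd p)))"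
    (is "_ = (?l, ?r)")
proof -
  have a: "a \<in> carrier k" and b: "b \<in> carrier k" and f: "f \<in> carrier F" and g: "g \<in> carrier F"
    using assms by (auto simp: rack_space_def direct_sum_def self_module_def)
  have fc: "f x \<in> carrier k" and gc: "g x \<in> carrier k" if "x \<in> X" for x
    using f g that by (auto simp: free_module_simps[OF k])
  have fin: "finite {x \<in> X. f x \<noteq> \<zero>\<^bsub>k\<^esub>}" "finite {x \<in> X. g x \<noteq> \<zero>\<^bsub>k\<^esub>}"
    using f g by (simp_all add: free_module_simps[OF k])
  have basis: "free_basis k X (rop x y) \<in> carrier F" if "x \<in> X" "y \<in> X" for x y
    using that by (intro free_basis_closed[OF k] rop)
  define U where "U = free_lift k X W (\<lambda>y. e) g"
  define V where "V x = free_lift k X W (\<lambda>y. \<iota> (rop x y)) g" for x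
  have U: "U \<in> carrier W"
    unfolding U_def
    by (rule mod_hom.f_im[OF free_lift_mod_hom[OF rack_space_module rack_unit_closed] g])
  have V: "V x \<in> carrier W" if "x \<in> X" for x
    unfolding V_def
    by (rule mod_hom.f_im[OF free_lift_mod_hom[OF rack_space_module] g])
      (intro rack_elem_closed rop that)
  have form: "rack_form (a, f) (b, g) = a \<odot>\<^bsub>W\<^esub> U \<oplus>\<^bsub>W\<^esub> free_lift k X W V f"
  proof -
    have "rack_extend k X W \<zero>\<^bsub>W\<^esub> (\<lambda>y. e) (b, g) = U"
      using b U by (simp add: rack_extend_def U_def)
    moreover have "free_lift k X W (\<lambda>x. rack_extend k X W \<zero>\<^bsub>W\<^esub> (\<lambda>y. \<iota> (rop x y)) (b, g)) f
        = free_lift k X W V f"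
      unfolding free_lift_def[of k X W _ f]
      using b V fc by (intro W.M.finsum_cong') (auto simp: rack_extend_def V_def)
    ultimately show ?thesis
      by (simp add: rack_form_def rack_extend_def[of k X W _ _ "(a, f)"])
  qed
  have fl: "free_lift k X W V f \<in> carrier W"
    by (rule mod_hom.f_im[OF free_lift_mod_hom[OF rack_space_module V] f])
  note fst_lift = mod_hom_free_lift[OF rack_space_fst] and snd_lift = mod_hom_free_lift[OF rack_space_snd]
  have fstU: "fst U = (\<Oplus>\<^bsub>k\<^esub>y \<in> {y \<in> X. g y \<noteq> \<zero>\<^bsub>k\<^esub>}. g y)"
  proof -
    have "fst U = free_lift k X K (\<lambda>y. \<one>\<^bsub>k\<^esub>) g"
      unfolding U_def by (subst fst_lift) (auto simp: rack_unit_closed g, simp add: rack_unit_eq)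
    also have "\<dots> = (\<Oplus>\<^bsub>k\<^esub>y \<in> {y \<in> X. g y \<noteq> \<zero>\<^bsub>k\<^esub>}. g y)"
      unfolding free_lift_def finsum_self_module
      using gc by (intro k.finsum_cong') (auto simp: self_module_def)
    finally show ?thesis .
  qed
  have sndU: "snd U = \<zero>\<^bsub>F\<^esub>"
  proof -
    have "snd U = free_lift k X F (\<lambda>y. \<zero>\<^bsub>F\<^esub>) g"
      unfolding U_def by (subst snd_lift) (auto simp: rack_unit_closed g, simp add: rack_unit_eq)
    then show ?thesis
      using free_lift_zero[OF F.module_axioms g] by simp
  qed
  have fstV: "fst (V x) = \<zero>\<^bsub>K\<^esub>" if x: "x \<in> X" for x
  proof -
    have "fst (V x) = free_lift k X K (\<lambda>y. \<zero>\<^bsub>K\<^esub>) g"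
      unfolding V_def using x
      by (subst fst_lift) (auto simp: rack_elem_closed rop g, simp add: rack_elem_eq self_module_def)
    then show ?thesis
      using free_lift_zero[OF K.module_axioms g] by simp
  qed
  have sndV: "snd (V x) = (\<Oplus>\<^bsub>F\<^esub>y \<in> {y \<in> X. g y \<noteq> \<zero>\<^bsub>k\<^esub>}. g y \<odot>\<^bsub>F\<^esub> free_basis k X (rop x y))"
    if x: "x \<in> X" for x
  proof -
    have "snd (V x) = free_lift k X F (\<lambda>y. free_basis k X (rop x y)) g"
      unfolding V_def using x
      by (subst snd_lift) (auto simp: rack_elem_closed rop g, simp add: rack_elem_eq)
    then show ?thesis
      by (simp add: free_lift_def)
  qed
  have "fst (rack_form (a, f) (b, g)) = a \<otimes>\<^bsub>k\<^esub> fst U \<oplus>\<^bsub>k\<^esub> free_lift k X K (\<lambda>x. fst (V x)) f"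
    unfolding form
    using mod_hom_map_add[OF rack_space_fst W.smult_closed[OF a U] fl]
      mod_hom_map_smult[OF rack_space_fst a U] fst_lift[where \<phi> = V, OF V f]
    by (simp add: self_module_def)
  also have "free_lift k X K (\<lambda>x. fst (V x)) f = \<zero>\<^bsub>k\<^esub>"
    unfolding free_lift_def using fc
    by (intro trans[OF K.M.add.finprod_one_eqI]) (auto simp: fstV, simp add: self_module_def)
  also have "a \<otimes>\<^bsub>k\<^esub> fst U \<oplus>\<^bsub>k\<^esub> \<zero>\<^bsub>k\<^esub> = ?l"
    unfolding fstU using a gc fin by (subst k.finsum_rdistr[symmetric]) (auto intro!: k.finsum_closed)
  finally have l: "fst (rack_form (a, f) (b, g)) = ?l" .
  have "snd (rack_form (a, f) (b, g)) = free_lift k X F (\<lambda>x. snd (V x)) f"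
    unfolding form
    using mod_hom_map_add[OF rack_space_snd W.smult_closed[OF a U] fl]
      mod_hom_map_smult[OF rack_space_snd a U] snd_lift[where \<phi> = V, OF V f] a
      mod_hom.f_im[OF rack_space_snd fl]
    by (simp add: sndU)
  also have "\<dots> = (\<Oplus>\<^bsub>F\<^esub>x \<in> {x \<in> X. f x \<noteq> \<zero>\<^bsub>k\<^esub>}. \<Oplus>\<^bsub>F\<^esub>y \<in> {y \<in> X. g y \<noteq> \<zero>\<^bsub>k\<^esub>}.
      (f x \<otimes>\<^bsub>k\<^esub> g y) \<odot>\<^bsub>F\<^esub> free_basis k X (rop x y))"
    unfolding free_lift_def
  proof (rule F.M.finsum_cong')
    fix x
    assume x: "x \<in> {x \<in> X. f x \<noteq> \<zero>\<^bsub>k\<^esub>}"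
    then have "f x \<odot>\<^bsub>F\<^esub> snd (V x)
        = (\<Oplus>\<^bsub>F\<^esub>y \<in> {y \<in> X. g y \<noteq> \<zero>\<^bsub>k\<^esub>}. f x \<odot>\<^bsub>F\<^esub> (g y \<odot>\<^bsub>F\<^esub> free_basis k X (rop x y)))"
      using fc gc basis by (auto simp: sndV intro!: F.finsum_smult)
    also have "\<dots> = (\<Oplus>\<^bsub>F\<^esub>y \<in> {y \<in> X. g y \<noteq> \<zero>\<^bsub>k\<^esub>}. (f x \<otimes>\<^bsub>k\<^esub> g y) \<odot>\<^bsub>F\<^esub> free_basis k X (rop x y))"
      using x fc gc basis by (intro F.M.finsum_cong') (auto simp: F.smult_assoc1)
    finally show "f x \<odot>\<^bsub>F\<^esub> snd (V x)
        = (\<Oplus>\<^bsub>F\<^esub>y \<in> {y \<in> X. g y \<noteq> \<zero>\<^bsub>k\<^esub>}. (f x \<otimes>\<^bsub>k\<^esub> g y) \<odot>\<^bsub>F\<^esub> free_basis k X (rop x y))" .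
  qed (use fc gc basis in \<open>auto intro!: F.M.finsum_closed\<close>)
  also have "\<dots> = ?r"
    using fc gc basis by (subst F.M.finsum_Times[OF fin]) auto
  finally have r: "snd (rack_form (a, f) (b, g)) = ?r" .
  from l r show ?thesis
    by (metis prod.collapse)
qed

lemma
  shows rack_q_mod_hom: "mod_hom k (tensor_product k W W) W (rack_q k X rop)"
    and rack_q_tensor: "w \<in> carrier W \<Longrightarrow> v \<in> carrier W \<Longrightarrow>
      rack_q k X rop (tensor k W W w v) = rack_form w v"
proof -
  define \<beta> :: "'r \<times> ('x \<Rightarrow> 'r) \<Rightarrow> 'r \<times> ('x \<Rightarrow> 'r) \<Rightarrow> 'r \<times> ('x \<Rightarrow> 'r)" where "\<beta> = (\<lambda>(a, f) (b, g).
        (\<Oplus>\<^bsub>k\<^esub> y \<in> {y \<in> X. g y \<noteq> \<zero>\<^bsub>k\<^esub>}. a \<otimes>\<^bsub>k\<^esub> g y,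
         \<Oplus>\<^bsub>F\<^esub> p \<in> {x \<in> X. f x \<noteq> \<zero>\<^bsub>k\<^esub>} \<times> {y \<in> X. g y \<noteq> \<zero>\<^bsub>k\<^esub>}.
           (f (fst p) \<otimes>\<^bsub>k\<^esub> g (snd p)) \<odot>\<^bsub>F\<^esub> free_basis k X (rop (fst p) (snd p))))"
  have q: "rack_q k X rop = tensor_lift k W W W \<beta>"
    by (simp add: rack_q_def Let_def \<beta>_def)
  have eq: "rack_form w v = \<beta> w v" if "w \<in> carrier W" "v \<in> carrier W" for w v
    using rack_form_eq[of "fst w" "snd w" "fst v" "snd v"] that
    by (simp add: \<beta>_def case_prod_beta)
  have \<beta>: "bilinear_map k W W W \<beta>"
    unfolding bilinear_map_def
  proof (intro conjI ballI rack_space_module)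
    show "mod_hom k W W (\<lambda>w. \<beta> w v)" if v: "v \<in> carrier W" for v
      by (rule mod_hom_cong[OF bilinear_mapD(4)[OF rack_form_bilinear v]]) (rule eq[OF _ v])
    show "mod_hom k W W (\<beta> w)" if w: "w \<in> carrier W" for w
      by (rule mod_hom_cong[OF bilinear_mapD(5)[OF rack_form_bilinear w]]) (rule eq[OF w])
  qed
  show "mod_hom k (tensor_product k W W) W (rack_q k X rop)"
    unfolding q by (rule tensor_lift_mod_hom[OF rack_space_module rack_space_module \<beta>])
  show "rack_q k X rop (tensor k W W w v) = rack_form w v" if "w \<in> carrier W" "v \<in> carrier W"
    unfolding q
    using tensor_lift_tensor[OF rack_space_module rack_space_module \<beta> that] eq[OF that] by simp
qed

end

end

hide_const (open) K F W e \<iota>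

theorem proposition3p1:
  fixes k :: "('r, 'd) ring_scheme" and X :: "'x set" and rop :: "'x \<Rightarrow> 'x \<Rightarrow> 'x"
  assumes "field k" and "rack X rop"
  defines "W \<equiv> rack_space k X"
    and "\<Delta> \<equiv> rack_comult k X"
    and "\<epsilon> \<equiv> rack_counit k X"
    and "q \<equiv> rack_q k X rop"
    and "e \<equiv> rack_unit k X"
    and "\<iota> \<equiv> rack_elem k X"
  shows "coalgebra k W \<Delta> \<epsilon> \<and>
    linear_map k (tensor_product k W W) W q \<and>
    (\<forall>x \<in> X. \<forall>y \<in> X. q (tensor k W W (\<iota> x) (\<iota> y)) = \<iota> (rop x y)) \<and>
    (\<forall>x \<in> X. q (tensor k W W e (\<iota> x)) = e) \<and>
    (\<forall>x \<in> X. q (tensor k W W (\<iota> x) e) = \<zero>\<^bsub>W\<^esub>) \<and>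
    q (tensor k W W e e) = \<zero>\<^bsub>W\<^esub> \<and>
    self_distributive k W \<Delta> q \<and>
    comult_compatible k W \<Delta> q"
proof -
  interpret k: field k by fact
  interpret X: rack X rop by fact
  have k: "cring k"
    by (rule k.is_cring)
  let ?WW = "tensor_product k W W" and ?G = "insert e (\<iota> ` X)"
  have W: "module k W"
    unfolding W_def by (rule rack_space_module[OF k])
  interpret W: module k W by (rule W)
  have e: "e \<in> carrier W" and \<iota>: "x \<in> X \<Longrightarrow> \<iota> x \<in> carrier W" for x
    unfolding W_def e_def \<iota>_def by (rule rack_unit_closed[OF k] rack_elem_closed[OF k]; assumption?)+
  have G: "?G \<subseteq> carrier W" "module.span k W ?G = carrier W"
    using e \<iota> span_rack_space[OF k, of X] by (auto simp: W_def e_def \<iota>_def)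

  have WW: "module k ?WW"
    by (rule tensor_product_module[OF W W])
  have \<Delta>_eq: "\<Delta> = rack_extend k X ?WW (tensor k W W e e) (\<lambda>x. tensor k W W (\<iota> x) (\<iota> x))"
    by (simp add: \<Delta>_def rack_comult_def Let_def W_def e_def \<iota>_def)
  have ee: "tensor k W W e e \<in> carrier ?WW"
    and \<iota>\<iota>: "x \<in> X \<Longrightarrow> tensor k W W (\<iota> x) (\<iota> x) \<in> carrier ?WW" for x
    using e \<iota> by (auto intro: tensor_closed[OF W W])
  have \<Delta>: "mod_hom k W ?WW \<Delta>"
    unfolding \<Delta>_eq using rack_extend_mod_hom[OF k WW ee \<iota>\<iota>] by (simp add: W_def)
  note unit = rack_extend_unit[where k = k and X = X, folded e_def, OF k]
    and elem = rack_extend_elem[where k = k and X = X, folded \<iota>_def, OF k]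
  have "\<Delta> e = tensor k W W e e"
    unfolding \<Delta>_eq by (rule unit[OF WW ee]) (rule \<iota>\<iota>)
  moreover have "\<Delta> (\<iota> x) = tensor k W W (\<iota> x) (\<iota> x)" if "x \<in> X" for x
    unfolding \<Delta>_eq using that by (intro elem[OF WW ee] \<iota>\<iota>)
  ultimately have grouplike: "\<Delta> g = tensor k W W g g" if "g \<in> ?G" for g
    using that by auto

  have K: "module k (self_module k)"
    by (rule self_module_module[OF k])
  have one: "\<one>\<^bsub>k\<^esub> \<in> carrier (self_module k)"
    by (simp add: self_module_def)
  have \<epsilon>: "mod_hom k W (self_module k) \<epsilon>"
    unfolding W_def \<epsilon>_def rack_counit_def by (rule rack_extend_mod_hom[OF k K one one])
  have \<epsilon>_one: "\<epsilon> g = \<one>\<^bsub>k\<^esub>" if "g \<in> ?G" for g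
    using that unit[OF K one one] elem[OF K one one] by (auto simp: \<epsilon>_def rack_counit_def)

  have q: "mod_hom k ?WW W q"
    unfolding W_def q_def by (rule rack_q_mod_hom[OF k X.closed])
  have q_basis: "q (tensor k W W e e) = \<zero>\<^bsub>W\<^esub>"
    "x \<in> X \<Longrightarrow> q (tensor k W W e (\<iota> x)) = e"
    "x \<in> X \<Longrightarrow> q (tensor k W W (\<iota> x) e) = \<zero>\<^bsub>W\<^esub>"
    "x \<in> X \<Longrightarrow> y \<in> X \<Longrightarrow> q (tensor k W W (\<iota> x) (\<iota> y)) = \<iota> (rop x y)" for x y
    unfolding W_def q_def e_def \<iota>_def
    by (simp_all add: rack_q_tensor[OF k] rack_form_basis[OF k] rack_unit_closed[OF k]
        rack_elem_closed[OF k] X.closed)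
  have q_zero: "q (tensor k W W \<zero>\<^bsub>W\<^esub> w) = \<zero>\<^bsub>W\<^esub>" if "w \<in> carrier W" for w
    by (rule mod_hom.f0_is_0[OF mod_hom_comp[OF tensor_mod_hom(1)[OF W W that] q]])

  have "coalgebra k W \<Delta> \<epsilon>"
    by (rule coalgebra_of_grouplikes[OF \<Delta> G grouplike assms(1) \<epsilon> \<epsilon>_one])
  moreover have "comult_compatible k W \<Delta> q"
  proof (rule comult_compatible_of_grouplikes[OF \<Delta> G grouplike q])
    show "q (tensor k W W g h) \<in> insert \<zero>\<^bsub>W\<^esub> ?G" if "g \<in> ?G" "h \<in> ?G" for g h
      using that by (elim insertE imageE) (simp_all add: q_basis X.closed)
  qed
  moreover have "self_distributive k W \<Delta> q"
  proof (rule self_distributive_of_grouplikes[OF \<Delta> G grouplike q])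
    show "q (tensor k W W (q (tensor k W W a b)) c)
        = q (tensor k W W (q (tensor k W W a c)) (q (tensor k W W b c)))"
      if "a \<in> ?G" "b \<in> ?G" "c \<in> ?G" for a b c
      using that by (elim insertE imageE)
        (simp_all add: q_basis q_zero e \<iota> X.closed flip: X.self_distrib)
  qed
  ultimately show ?thesis
    using q q_basis linear_map_iff_mod_hom[OF assms(1)] by blast
qed

end
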